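(* (Harnack-type inequality.) Let $(\Psi, g^{T\Psi})$ be a half-translation surface with piecewise geodesic boundary, tiled by euclidean squares of area $1$, endowed with a flat unitary vector bundle $(F,h^F,\nabla^F)$, with associated graphs $\Psi_n$ and bundles $(F_n,h^{F_n},\nabla^{F_n})$, $n\in\mathbb{N}^*$. Fix $\lambda>0$. Suppose that a sequence $f_n\in\mathrm{Map}(V(\Psi_n),F_n)$, $n\in\mathbb{N}^*$, with $\|f_n\|^2_{L^2(\Psi_n,F_n)}=n^2$, satisfies $$\big|\Delta_{\Psi_n}^{F_n}f_n(P)\big|\le\frac{\lambda}{n^2}\,|f_n(P)|\qquad\text{for all }P\in V(\Psi_n).$$ Then, as $n\to\infty$, $$\max_{(P,Q)\in E(\Psi_n)}\big|f_n(P)-f_n(Q)\big|\to0,$$ where the values at $P$ and $Q$ are compared by means of the parallel transport along the edge $(P,Q)$.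
   Context: Surface. $\overline\Psi$ is a compact surface, possibly with boundary, carrying a flat metric $g^{T\Psi}$ with a finite set $\mathrm{Con}(\Psi)$ of (interior) conical points; $\Psi=\overline\Psi\setminus\mathrm{Con}(\Psi)$ (it contains its boundary $\partial\Psi$). Near a conical point of angle $\theta\ne2\pi$ the metric is $dr^2+r^2dt^2$, $r>0$, $t\in\mathbb{R}/\theta\mathbb{Z}$. Half-translation means that all conical angles are $k\pi$, $k\in\mathbb{N}^*\setminus\{2\}$. The boundary is piecewise geodesic; $\mathrm{Ang}(\Psi)\subset\partial\Psi$ is the finite set of corners (points where two smooth pieces of the boundary meet). The tiling by unit squares covers $\overline\Psi$ without overlaps on sets of positive measure, is edge-to-edge, conical points and corners are vertices of tiles, $\partial\Psi$ is a union of sides of tiles, and the interior angles at corners are $k\pi/2$, $k\in\mathbb{N}^*\setminus\{2\}$. Bundle. $(F,h^F,\nabla^F)$ is a Hermitian complex vector bundle over $\overline\Psi$ with connection such that $(\nabla^F)^2=0$ and $\nabla^F$ preserves $h^F$ (so monodromies around conical points are trivial). Discretization. For $n\in\mathbb{N}^*$ subdivide each tile into $n^2$ equal squares of side $1/n$. $V(\Psi_n)\subset\Psi$ is the set of centers of these small squares; $E(\Psi_n)$ joins nearest neighbors for the flat metric: one edge for each common side of two small squares, joining their centers (multiple edges are possible). $F_n,h^{F_n}$ are the restrictions of $F,h^F$ to $V(\Psi_n)$; for an edge $(v,v')$, $\phi_{vv'}:F_v\to F_{v'}$ is the $\nabla^F$-parallel transport along the corresponding straight segment. $\mathrm{Map}(V(\Psi_n),F_n)=\bigoplus_v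 F_v$ has the scalar product $\langle f,g\rangle_{L^2(\Psi_n,F_n)}=\sum_v h^F(f(v),g(v))$; $|\cdot|$ is the pointwise norm for $h^F$. The discrete Laplacian is $\Delta_{\Psi_n}^{F_n}f(v)=\sum_{(v,v')\in E(\Psi_n)}(f(v)-\phi_{v'v}f(v'))$ (sum over edges with multiplicity). *)

theory Defs
  imports "HOL-Analysis.Analysis"
begin

section \<open>Flat surfaces with conical points and piecewise geodesic boundary\<close>

text \<open>
  A flat metric is handled through its distance function. In the metric
  \<open>dr\<^sup>2 + r\<^sup>2 dt\<^sup>2\<close>, two points at radii \<open>r\<close>, \<open>r'\<close> seen from the apex under the
  angle \<open>\<delta>\<close> are joined by a straight chord if \<open>\<delta> < \<pi>\<close>, and otherwise by the two radii
  through the apex.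
\<close>

definition cone_dist :: "real \<Rightarrow> real \<Rightarrow> real \<Rightarrow> real" where
  "cone_dist \<delta> r r' = sqrt (r\<^sup>2 + r'\<^sup>2 - 2 * r * r' * cos (min \<delta> pi))"

text \<open>
  Near \<open>p\<close> the space \<open>X\<close> is a cone of angle \<open>\<theta>\<close> with apex \<open>p\<close>: \<open>P r t\<close> is the point with polar
  coordinates \<open>(r, t)\<close>, \<open>t \<in> \<real>/\<theta>\<int>\<close>. The case \<open>\<theta> = 2\<pi>\<close> is a Euclidean disc.
\<close>

definition cone_point :: "'a::metric_space set \<Rightarrow> 'a \<Rightarrow> real \<Rightarrow> bool" where
  "cone_point X p \<theta> \<longleftrightarrow> \<theta> > 0 \<and>
     (\<exists>\<epsilon>>0. \<exists>P :: real \<Rightarrow> real \<Rightarrow> 'a. P 0 0 = p \<and>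
        (\<lambda>(r, t). P r t) ` ({0..<\<epsilon>} \<times> {0..<\<theta>}) = X \<inter> ball p \<epsilon> \<and>
        (\<forall>r\<in>{0..<\<epsilon>}. \<forall>r'\<in>{0..<\<epsilon>}. \<forall>t\<in>{0..<\<theta>}. \<forall>t'\<in>{0..<\<theta>}.
           dist (P r t) (P r' t') = cone_dist (min \<bar>t - t'\<bar> (\<theta> - \<bar>t - t'\<bar>)) r r'))"

text \<open>
  Near \<open>p\<close> the space \<open>X\<close> is a sector of angle \<open>\<theta>\<close> with apex \<open>p\<close>. The case \<open>\<theta> = \<pi>\<close> is a
  Euclidean half-disc.
\<close>

definition sector_point :: "'a::metric_space set \<Rightarrow> 'a \<Rightarrow> real \<Rightarrow> bool" where
  "sector_point X p \<theta> \<longleftrightarrow> \<theta> > 0 \<and>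
     (\<exists>\<epsilon>>0. \<exists>P :: real \<Rightarrow> real \<Rightarrow> 'a. P 0 0 = p \<and>
        (\<lambda>(r, t). P r t) ` ({0..<\<epsilon>} \<times> {0..\<theta>}) = X \<inter> ball p \<epsilon> \<and>
        (\<forall>r\<in>{0..<\<epsilon>}. \<forall>r'\<in>{0..<\<epsilon>}. \<forall>t\<in>{0..\<theta>}. \<forall>t'\<in>{0..\<theta>}.
           dist (P r t) (P r' t') = cone_dist \<bar>t - t'\<bar> r r'))"

definition conical_points :: "'a::metric_space set \<Rightarrow> 'a set" where
  "conical_points X = {p \<in> X. \<exists>\<theta>. \<theta> \<noteq> 2 * pi \<and> cone_point X p \<theta>}"

definition surface_boundary :: "'a::metric_space set \<Rightarrow> 'a set" where
  "surface_boundary X = {p \<in> X. \<exists>\<theta>. sector_point X p \<theta>}"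

definition corners :: "'a::metric_space set \<Rightarrow> 'a set" where
  "corners X = {p \<in> X. \<exists>\<theta>. \<theta> \<noteq> pi \<and> sector_point X p \<theta>}"

abbreviation singular_points :: "'a::metric_space set \<Rightarrow> 'a set" where
  "singular_points X \<equiv> conical_points X \<union> corners X"

definition flat_surface :: "'a::metric_space set \<Rightarrow> bool" where
  "flat_surface X \<longleftrightarrow> compact X \<and>
     (\<forall>p\<in>X. \<exists>\<theta>. cone_point X p \<theta> \<or> sector_point X p \<theta>) \<and>
     finite (conical_points X) \<and> finite (corners X)"

definition half_translation_surface :: "'a::metric_space set \<Rightarrow> bool" where
  "half_translation_surface X \<longleftrightarrow> flat_surface X \<and>
     (\<forall>p\<in>conical_points X. \<forall>\<theta>. cone_point X p \<theta> \<longrightarrow>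
        (\<exists>k::nat. k \<ge> 1 \<and> k \<noteq> 2 \<and> \<theta> = real k * pi))"


section \<open>Tilings by unit squares\<close>

definition locally_isometric_on ::
    "'b::metric_space set \<Rightarrow> ('b \<Rightarrow> 'a::metric_space) \<Rightarrow> bool" where
  "locally_isometric_on S \<tau> \<longleftrightarrow>
     (\<forall>z\<in>S. \<exists>\<epsilon>>0. \<forall>x\<in>S \<inter> ball z \<epsilon>. \<forall>y\<in>S \<inter> ball z \<epsilon>. dist (\<tau> x) (\<tau> y) = dist x y)"

definition unit_square :: "(real \<times> real) set" where
  "unit_square = {0..1} \<times> {0..1}"

definition open_square :: "(real \<times> real) set" where
  "open_square = {0<..<1} \<times> {0<..<1}"

definition square_vertices :: "(real \<times> real) set" where
  "square_vertices = {0, 1} \<times> {0, 1}"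

text \<open>
  The sides of an axis-parallel square with centre \<open>c\<close> and side length \<open>l\<close> are indexed by
  their outward unit normals \<open>d\<close>.
\<close>

definition directions :: "(real \<times> real) set" where
  "directions = {(1, 0), (0, 1), (- 1, 0), (0, - 1)}"

definition quarter_turn :: "real \<times> real \<Rightarrow> real \<times> real" where
  "quarter_turn d = (- snd d, fst d)"

definition side :: "real \<times> real \<Rightarrow> real \<Rightarrow> real \<times> real \<Rightarrow> (real \<times> real) set" where
  "side c l d = (\<lambda>s. c + (l / 2) *\<^sub>R d + (s * l) *\<^sub>R quarter_turn d) ` {- 1/2..1/2}"

definition open_side :: "real \<times> real \<Rightarrow> real \<Rightarrow> real \<times> real \<Rightarrow> (real \<times> real) set" where
  "open_side c l d = (\<lambda>s. c + (l / 2) *\<^sub>R d + (s * l) *\<^sub>R quarter_turn d) ` {- 1/2<..<1/2}"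

abbreviation tile_side :: "real \<times> real \<Rightarrow> (real \<times> real) set" where
  "tile_side \<equiv> side (1/2, 1/2) 1"

abbreviation open_tile_side :: "real \<times> real \<Rightarrow> (real \<times> real) set" where
  "open_tile_side \<equiv> open_side (1/2, 1/2) 1"

text \<open>
  The tiles are the images \<open>\<tau> i ` unit_square\<close>, \<open>i \<in> I\<close>. The maps \<open>\<tau> i\<close> are only locally
  isometric, because sides or vertices of one tile may be identified in the surface.
\<close>

definition edge_to_edge :: "'i set \<Rightarrow> ('i \<Rightarrow> real \<times> real \<Rightarrow> 'a) \<Rightarrow> bool" where
  "edge_to_edge I \<tau> \<longleftrightarrow>
     (\<forall>i\<in>I. \<forall>j\<in>I. \<tau> i ` open_square \<inter> \<tau> j ` (unit_square - open_square) = {}) \<and>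
     (\<forall>i\<in>I. \<forall>j\<in>I. \<forall>d\<in>directions.
        \<tau> i ` open_tile_side d \<inter> \<tau> j ` square_vertices = {}) \<and>
     (\<forall>i\<in>I. \<forall>j\<in>I. \<forall>d\<in>directions. \<forall>d'\<in>directions.
        \<tau> i ` open_tile_side d \<inter> \<tau> j ` open_tile_side d' \<noteq> {} \<longrightarrow>
        \<tau> i ` open_tile_side d = \<tau> j ` open_tile_side d')"

definition square_tiling ::
    "'a::metric_space set \<Rightarrow> 'i set \<Rightarrow> ('i \<Rightarrow> real \<times> real \<Rightarrow> 'a) \<Rightarrow> bool" where
  "square_tiling X I \<tau> \<longleftrightarrow>
     finite I \<and>
     (\<forall>i\<in>I. locally_isometric_on unit_square (\<tau> i)) \<and>
     (\<Union>i\<in>I. \<tau> i ` unit_square) = X \<and>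
     inj_on (\<lambda>(i, z). \<tau> i z) (I \<times> open_square) \<and>
     edge_to_edge I \<tau> \<and>
     singular_points X \<subseteq> (\<Union>i\<in>I. \<tau> i ` square_vertices) \<and>
     (\<exists>S \<subseteq> I \<times> directions. surface_boundary X = (\<Union>(i, d)\<in>S. \<tau> i ` tile_side d)) \<and>
     (\<forall>p\<in>corners X. \<forall>\<theta>. sector_point X p \<theta> \<longrightarrow>
        (\<exists>k::nat. k \<ge> 1 \<and> k \<noteq> 2 \<and> \<theta> = real k * pi / 2))"


section \<open>Flat unitary vector bundles\<close>

text \<open>
  \<open>C\<^sup>\<infinity>\<close> on a subset of the plane, with one-sided derivatives at boundary points:
  \<open>D i j\<close> is the partial derivative of order \<open>(i, j)\<close>.
\<close>

definition smooth_on :: "(real \<times> real) set \<Rightarrow> (real \<times> real \<Rightarrow> 'v::real_normed_vector) \<Rightarrow> bool" where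
  "smooth_on S f \<longleftrightarrow>
     (\<exists>D :: nat \<Rightarrow> nat \<Rightarrow> real \<times> real \<Rightarrow> 'v.
        (\<forall>z\<in>S. D 0 0 z = f z) \<and>
        (\<forall>i j. \<forall>z\<in>S. (D i j has_derivative
            (\<lambda>v. fst v *\<^sub>R D (Suc i) j z + snd v *\<^sub>R D i (Suc j) z)) (at z within S)))"

text \<open>
  The fibre of \<open>F\<close> over \<open>x\<close> is \<open>\<complex>\<^sup>r\<close> with the Hermitian product \<open>h x\<close>, where \<open>r = CARD('r)\<close>.
  This identification of the individual fibres with \<open>\<complex>\<^sup>r\<close> is not required to depend on \<open>x\<close> in
  any regular way; in particular the bundle need not be trivial. The smooth structure and the
  connection are given by local gauges: on an open set \<open>gdom\<close> of regular points, \<open>gchart\<close> is a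
  flat coordinate, the columns of \<open>gframe x\<close> are a frame of \<open>F\<close> at \<open>x\<close>, and in this frame
  \<open>\<nabla> = d + A\<close> with \<open>A = A\<^sub>1 dx + A\<^sub>2 dy\<close>, where \<open>A\<^sub>1 = gform1\<close> and \<open>A\<^sub>2 = gform2\<close> are functions
  of the coordinate.
\<close>

record ('a, 'r) gauge =
  gdom :: "'a set"
  gchart :: "'a \<Rightarrow> real \<times> real"
  gframe :: "'a \<Rightarrow> complex ^ 'r ^ 'r"
  gform1 :: "real \<times> real \<Rightarrow> complex ^ 'r ^ 'r"
  gform2 :: "real \<times> real \<Rightarrow> complex ^ 'r ^ 'r"

definition connection_form ::
    "('a, 'r::finite) gauge \<Rightarrow> real \<times> real \<Rightarrow> real \<times> real \<Rightarrow> complex ^ 'r ^ 'r" where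
  "connection_form g z v = fst v *\<^sub>R gform1 g z + snd v *\<^sub>R gform2 g z"

definition in_chart :: "('a, 'r::finite) gauge \<Rightarrow> ('a \<Rightarrow> 'v) \<Rightarrow> real \<times> real \<Rightarrow> 'v" where
  "in_chart g u z = u (inv_into (gdom g) (gchart g) z)"

definition hermitian_product :: "(complex ^ 'r::finite \<Rightarrow> complex ^ 'r \<Rightarrow> complex) \<Rightarrow> bool" where
  "hermitian_product h \<longleftrightarrow>
     (\<forall>u v w. h (u + v) w = h u w + h v w) \<and>
     (\<forall>c u w. h (c *s u) w = c * h u w) \<and>
     (\<forall>u w. h w u = cnj (h u w)) \<and>
     (\<forall>u. u \<noteq> 0 \<longrightarrow> Re (h u u) > 0)"

definition gauge_on :: "'a::metric_space set \<Rightarrow> ('a, 'r::finite) gauge \<Rightarrow> bool" where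
  "gauge_on X g \<longleftrightarrow>
     openin (top_of_set X) (gdom g) \<and>
     gdom g \<inter> singular_points X = {} \<and>
     (\<forall>x\<in>gdom g. \<forall>y\<in>gdom g. dist (gchart g x) (gchart g y) = dist x y) \<and>
     (\<forall>x\<in>gdom g. invertible (gframe g x)) \<and>
     smooth_on (gchart g ` gdom g) (gform1 g) \<and>
     smooth_on (gchart g ` gdom g) (gform2 g)"

text \<open>
  On the overlap of two gauges, let \<open>G\<close> be the change of frame and \<open>\<kappa>\<close> the change of coordinate.
  Then \<open>G\<close> is smooth and \<open>G A' = (\<kappa>\<^sup>* A) G + dG\<close>.
\<close>

definition gauges_compatible :: "('a, 'r::finite) gauge \<Rightarrow> ('a, 'r) gauge \<Rightarrow> bool" where
  "gauges_compatible g g' \<longleftrightarrow>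
     (let W = gdom g \<inter> gdom g';
          S = gchart g' ` W;
          G = (\<lambda>x. matrix_inv (gframe g x) ** gframe g' x)
      in smooth_on S (in_chart g' G) \<and>
         (\<forall>x\<in>W. \<exists>\<kappa>' G'.
            (in_chart g' (gchart g) has_derivative \<kappa>') (at (gchart g' x) within S) \<and>
            (in_chart g' G has_derivative G') (at (gchart g' x) within S) \<and>
            (\<forall>v. G x ** connection_form g' (gchart g' x) v
                 = connection_form g (gchart g x) (\<kappa>' v) ** G x + G' v)))"

text \<open>
  \<open>h\<close> is smooth, and \<open>d (h(s, s')) = h(\<nabla>s, s') + h(s, \<nabla>s')\<close>; it suffices to say this for
  sections \<open>s\<close>, \<open>s'\<close> with constant coordinates \<open>a\<close>, \<open>b\<close> in the frame.
\<close>

definition preserves_metric ::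
    "('a \<Rightarrow> complex ^ 'r::finite \<Rightarrow> complex ^ 'r \<Rightarrow> complex) \<Rightarrow> ('a, 'r) gauge \<Rightarrow> bool" where
  "preserves_metric h g \<longleftrightarrow>
     (\<forall>a b.
        let S = gchart g ` gdom g;
            H = (\<lambda>x. h x (gframe g x *v a) (gframe g x *v b))
        in smooth_on S (in_chart g H) \<and>
           (\<forall>x\<in>gdom g. (in_chart g H has_derivative
              (\<lambda>v. h x (gframe g x *v (connection_form g (gchart g x) v *v a)) (gframe g x *v b)
                 + h x (gframe g x *v a) (gframe g x *v (connection_form g (gchart g x) v *v b))))
              (at (gchart g x) within S)))"

text \<open>The curvature \<open>dA + A \<and> A\<close> vanishes.\<close>

definition curvature_free :: "('a, 'r::finite) gauge \<Rightarrow> bool" where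
  "curvature_free g \<longleftrightarrow>
     (\<forall>z \<in> gchart g ` gdom g. \<exists>D1 D2.
        (gform1 g has_derivative D1) (at z within gchart g ` gdom g) \<and>
        (gform2 g has_derivative D2) (at z within gchart g ` gdom g) \<and>
        D2 (1, 0) - D1 (0, 1) + gform1 g z ** gform2 g z - gform2 g z ** gform1 g z = 0)"

text \<open>
  At a conical point or a corner \<open>p\<close> there is no flat coordinate. That the bundle with its flat
  connection is defined across \<open>p\<close> means that near \<open>p\<close> there is a frame \<open>e\<close> which is parallel on
  the punctured neighbourhood (in particular the monodromy around \<open>p\<close> is trivial) and which
  extends to a frame of the fibre at \<open>p\<close>, with constant scalar products.
\<close>

definition extends_across ::
    "'a::metric_space set \<Rightarrow> ('a \<Rightarrow> complex ^ 'r::finite \<Rightarrow> complex ^ 'r \<Rightarrow> complex) \<Rightarrow>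
     ('a, 'r) gauge set \<Rightarrow> 'a \<Rightarrow> bool" where
  "extends_across X h \<G> p \<longleftrightarrow>
     (\<exists>U (e :: 'a \<Rightarrow> complex ^ 'r ^ 'r).
        openin (top_of_set X) U \<and> p \<in> U \<and>
        (\<forall>x\<in>U. invertible (e x)) \<and>
        (\<forall>x\<in>U. \<forall>a b. h x (e x *v a) (e x *v b) = h p (e p *v a) (e p *v b)) \<and>
        (\<forall>g\<in>\<G>. \<forall>x \<in> gdom g \<inter> U.
           (in_chart g (\<lambda>y. matrix_inv (gframe g y) ** e y) has_derivative
              (\<lambda>v. - (connection_form g (gchart g x) v ** (matrix_inv (gframe g x) ** e x))))
              (at (gchart g x) within gchart g ` (gdom g \<inter> U))))"

definition flat_unitary_bundle ::
    "'a::metric_space set \<Rightarrow> ('a \<Rightarrow> complex ^ 'r::finite \<Rightarrow> complex ^ 'r \<Rightarrow> complex) \<Rightarrow>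
     ('a, 'r) gauge set \<Rightarrow> bool" where
  "flat_unitary_bundle X h \<G> \<longleftrightarrow>
     (\<forall>x\<in>X. hermitian_product (h x)) \<and>
     (\<forall>g\<in>\<G>. gauge_on X g) \<and>
     X - singular_points X \<subseteq> (\<Union>g\<in>\<G>. gdom g) \<and>
     (\<forall>g\<in>\<G>. \<forall>g'\<in>\<G>. gauges_compatible g g') \<and>
     (\<forall>g\<in>\<G>. preserves_metric h g) \<and>
     (\<forall>g\<in>\<G>. curvature_free g) \<and>
     (\<forall>p\<in>singular_points X. extends_across X h \<G> p)"

definition fibre_norm ::
    "('a \<Rightarrow> complex ^ 'r::finite \<Rightarrow> complex ^ 'r \<Rightarrow> complex) \<Rightarrow> 'a \<Rightarrow> complex ^ 'r \<Rightarrow> real" where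
  "fibre_norm h x u = sqrt (Re (h x u u))"

text \<open>
  \<open>s t\<close> lies in the fibre over \<open>\<gamma> t\<close>. In a gauge, \<open>s\<close> is parallel if its coordinate vector \<open>a\<close>
  satisfies \<open>a' + A(\<gamma>') a = 0\<close>. The curve has to avoid the singular points, so that every point of
  it lies in a gauge.
\<close>

definition parallel_along ::
    "'a::metric_space set \<Rightarrow> ('a, 'r::finite) gauge set \<Rightarrow> (real \<Rightarrow> 'a) \<Rightarrow>
     (real \<Rightarrow> complex ^ 'r) \<Rightarrow> bool" where
  "parallel_along X \<G> \<gamma> s \<longleftrightarrow>
     path \<gamma> \<and> path_image \<gamma> \<subseteq> X - singular_points X \<and>
     (\<forall>g\<in>\<G>. \<forall>t\<in>{0..1}. \<gamma> t \<in> gdom g \<longrightarrow>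
        (let a = (\<lambda>t. matrix_inv (gframe g (\<gamma> t)) *v s t)
         in \<exists>w. ((\<lambda>t. gchart g (\<gamma> t)) has_vector_derivative w) (at t within {0..1}) \<and>
                (a has_vector_derivative - (connection_form g (gchart g (\<gamma> t)) w *v a t))
                  (at t within {0..1})))"

definition is_parallel_transport ::
    "'a::metric_space set \<Rightarrow> ('a, 'r::finite) gauge set \<Rightarrow> (real \<Rightarrow> 'a) \<Rightarrow>
     (complex ^ 'r \<Rightarrow> complex ^ 'r) \<Rightarrow> bool" where
  "is_parallel_transport X \<G> \<gamma> \<phi> \<longleftrightarrow>
     (\<forall>u. \<exists>s. parallel_along X \<G> \<gamma> s \<and> s 0 = u \<and> s 1 = \<phi> u)"


section \<open>The graphs and their Laplacians\<close>

text \<open>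
  A dart \<open>(i, a, b, d)\<close> is the small square of side \<open>1/n\<close> in position \<open>(a, b)\<close> of the tile \<open>i\<close>,
  together with its side with outward normal \<open>d\<close>.
\<close>

type_synonym 'i dart = "'i \<times> nat \<times> nat \<times> (real \<times> real)"

definition darts :: "'i set \<Rightarrow> nat \<Rightarrow> 'i dart set" where
  "darts I n = I \<times> {..<n} \<times> {..<n} \<times> directions"

fun dart_tile :: "'i dart \<Rightarrow> 'i" where
  "dart_tile (i, a, b, d) = i"

fun dart_direction :: "'i dart \<Rightarrow> real \<times> real" where
  "dart_direction (i, a, b, d) = d"

fun local_center :: "nat \<Rightarrow> 'i dart \<Rightarrow> real \<times> real" where
  "local_center n (i, a, b, d) = ((real a + 1/2) / real n, (real b + 1/2) / real n)"

definition center :: "('i \<Rightarrow> real \<times> real \<Rightarrow> 'a) \<Rightarrow> nat \<Rightarrow> 'i dart \<Rightarrow> 'a" where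
  "center \<tau> n x = \<tau> (dart_tile x) (local_center n x)"

definition dart_side :: "('i \<Rightarrow> real \<times> real \<Rightarrow> 'a) \<Rightarrow> nat \<Rightarrow> 'i dart \<Rightarrow> 'a set" where
  "dart_side \<tau> n x = \<tau> (dart_tile x) ` side (local_center n x) (1 / real n) (dart_direction x)"

definition vertices :: "'i set \<Rightarrow> ('i \<Rightarrow> real \<times> real \<Rightarrow> 'a) \<Rightarrow> nat \<Rightarrow> 'a set" where
  "vertices I \<tau> n = center \<tau> n ` darts I n"

text \<open>
  A common side of two small squares gives two oriented edges, \<open>(x, y)\<close> and \<open>(y, x)\<close>, so the edges
  starting at a vertex are counted with multiplicity. For \<open>n = 1\<close> the two squares may coincide.
\<close>

definition oriented_edges ::
    "'i set \<Rightarrow> ('i \<Rightarrow> real \<times> real \<Rightarrow> 'a) \<Rightarrow> nat \<Rightarrow> ('i dart \<times> 'i dart) set" where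
  "oriented_edges I \<tau> n =
     {(x, y). x \<in> darts I n \<and> y \<in> darts I n \<and> x \<noteq> y \<and> dart_side \<tau> n x = dart_side \<tau> n y}"

text \<open>The straight segment from centre to centre, crossing the common side at its midpoint.\<close>

fun edge_segment ::
    "('i \<Rightarrow> real \<times> real \<Rightarrow> 'a) \<Rightarrow> nat \<Rightarrow> 'i dart \<times> 'i dart \<Rightarrow> real \<Rightarrow> 'a" where
  "edge_segment \<tau> n (x, y) t =
     (if t \<le> 1/2
      then \<tau> (dart_tile x) (local_center n x + (t / real n) *\<^sub>R dart_direction x)
      else \<tau> (dart_tile y) (local_center n y + ((1 - t) / real n) *\<^sub>R dart_direction y))"

text \<open>
  \<open>\<phi> (x, y)\<close> maps the fibre at the centre of \<open>x\<close> to the fibre at the centre of \<open>y\<close>.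
\<close>

definition laplacian ::
    "'i set \<Rightarrow> ('i \<Rightarrow> real \<times> real \<Rightarrow> 'a) \<Rightarrow> nat \<Rightarrow>
     ('i dart \<times> 'i dart \<Rightarrow> complex ^ 'r::finite \<Rightarrow> complex ^ 'r) \<Rightarrow>
     ('a \<Rightarrow> complex ^ 'r) \<Rightarrow> 'a \<Rightarrow> complex ^ 'r" where
  "laplacian I \<tau> n \<phi> f v =
     (\<Sum>(x, y) \<in> {e \<in> oriented_edges I \<tau> n. center \<tau> n (fst e) = v}.
        f v - \<phi> (y, x) (f (center \<tau> n y)))"

end

theory Submission
  imports Defs
begin

text \<open>
  Write \<open>w v = \<bar>f\<^sub>n v\<bar>\<close> for the pointwise norm and \<open>d (x, y)\<close> for the jump of \<open>f\<^sub>n\<close> across an edge. As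
  parallel transport is unitary, only the numbers \<open>w\<close> and \<open>c (x, y) = Re \<langle>f\<^sub>n x, \<phi> f\<^sub>n y\<rangle>\<close> matter:
  \<open>d\<^sup>2 = w\<^sub>x\<^sup>2 + w\<^sub>y\<^sup>2 - 2 c\<close>, the function \<open>c\<close> is symmetric with \<open>\<bar>c\<bar> \<le> w\<^sub>x w\<^sub>y\<close>, and the hypothesis on the
  Laplacian gives \<open>\<Sum>\<^sub>y (w\<^sub>x\<^sup>2 - c (x, y)) \<le> (\<lambda>/n\<^sup>2) w\<^sub>x\<^sup>2\<close> at every vertex \<open>x\<close>. These scalar inequalities,
  collected in the locale \<open>subsolution_graph\<close>, imply the theorem.

  The total energy \<open>\<Sum> d\<^sup>2\<close> is bounded (\<open>jump_energy\<close>), and two steps remain.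

  Sup bound (Moser iteration). Testing the inequality with \<open>w\<^bsup>2p-2\<^esup>\<close> bounds the energy of \<open>w\<^sup>p\<close> by
  \<open>(2 p \<lambda>/n\<^sup>2) \<Sum> w\<^bsup>2p\<^esup>\<close> (\<open>power_energy\<close>). A discrete Ladyzhenskaya inequality holds on each tile, which
  carries an \<open>n \<times> n\<close> grid, hence by summation on the whole graph (\<open>grid_sobolev\<close>,
  \<open>surface_sobolev\<close>); the gluing of the tiles only adds energy to the right-hand side. Iterating over
  \<open>p = 1, 2, 4, \<dots>\<close> gives \<open>w\<^sup>2 \<le> 32 (\<lambda> + 1)\<close> with no dependence on \<open>n\<close> (\<open>sup_bound\<close>).

  Smallness of the jumps (points have zero capacity in dimension two). Let \<open>\<psi>\<close> be a cutoff which is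
  \<open>1\<close> within distance \<open>s/n\<close> of a given edge and \<open>0\<close> beyond \<open>2s/n\<close>. Testing with \<open>\<psi>\<close> bounds \<open>d\<^sup>2\<close> on that
  edge by \<open>\<lambda>/n\<^sup>2\<close> times the mass of the small ball plus \<open>\<Sum> \<bar>\<nabla>\<psi>\<bar> d w\<close>. Since balls grow at most quadratically, the
  energy of \<open>\<psi>\<close> is bounded independently of \<open>s\<close>, so the last term is at most a constant times the
  square root of the energy of \<open>f\<^sub>n\<close> in the annulus between \<open>s/n\<close> and \<open>2s/n\<close>. Among the \<open>K\<close> disjoint
  annuli with \<open>s = 4, \<dots>, 4\<^sup>K\<close>, one carries at most the fraction \<open>1/K\<close> of the total energy. Choosing
  first \<open>K\<close> and then \<open>n\<close> large makes both terms small (\<open>jump_estimate\<close>).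

  The quadratic growth of balls (\<open>darts_in_ball_bound\<close>) follows from compactness: the tiles are covered by finitely many pieces
  on which the tile maps are isometric, and in each piece a ball of radius \<open>r/n\<close> pulls back to a planar
  set of diameter at most \<open>2r/n\<close>.
\<close>

section \<open>Subsolutions on finite graphs\<close>

text \<open>
  An elementary form, with \<open>p\<close> instead of the constant \<open>p\<^sup>2/(2p-1)\<close>, of
  \<open>(\<integral> p t\<^bsup>p-1\<^esup> dt)\<^sup>2 \<le> \<bar>a - b\<bar> \<integral> p\<^sup>2 t\<^bsup>2p-2\<^esup> dt\<close>. It is the pointwise inequality that
  turns \<open>w\<^bsup>2p-1\<^esup>\<close> as a test function into control of the energy of \<open>w\<^sup>p\<close>. The sum for \<open>(a\<^sup>p - b\<^sup>p)/(a - b)\<close>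
  is squared by Cauchy-Schwarz; the resulting monomials are the even ones in the sum for
  \<open>(a\<^bsup>2p-1\<^esup> - b\<^bsup>2p-1\<^esup>)/(a - b)\<close>.
\<close>

lemma power_diff_squared_le:
  fixes a b :: real
  assumes "a \<ge> 0" "b \<ge> 0" "p \<ge> 1"
  shows "(a ^ p - b ^ p)\<^sup>2 \<le> real p * ((a - b) * (a ^ (2 * p - 1) - b ^ (2 * p - 1)))"
proof -
  define t where "t i = a ^ i * b ^ (p - 1 - i)" for i
  have 1: "a ^ p - b ^ p = (a - b) * (\<Sum>i<p. t i)"
    using power_diff_sumr2[of a p b] unfolding t_def by (simp add: mult.commute)
  have 2: "a ^ (2*p - 1) - b ^ (2*p - 1) = (a - b) * (\<Sum>i<2*p - 1. a ^ i * b ^ (2*p - 1 - Suc i))"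
    using power_diff_sumr2[of a "2*p - 1" b] by (simp add: mult.commute)
  have cs: "(\<Sum>i<p. t i)\<^sup>2 \<le> real p * (\<Sum>i<p. (t i)\<^sup>2)"
    using sum_squared_le_sum_of_squares[of t "{..<p}"] by (simp add: mult.commute)
  have "(\<Sum>i<p. (t i)\<^sup>2) = (\<Sum>j\<in>(\<lambda>i. 2 * i) ` {..<p}. a ^ j * b ^ (2*p - 1 - Suc j))"
  proof (subst sum.reindex)
    have "2 * p - 1 - Suc (2 * i) = (p - 1 - i) * 2" if "i < p" for i using that by simp
    then show "(\<Sum>i<p. (t i)\<^sup>2) = sum ((\<lambda>j. a ^ j * b ^ (2*p - 1 - Suc j)) \<circ> (\<lambda>i. 2 * i)) {..<p}"
      by (intro sum.cong) (simp_all add: t_def power_mult_distrib power_mult mult.commute[of 2])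
  qed (auto simp: inj_on_def)
  also have "\<dots> \<le> (\<Sum>i<2*p - 1. a ^ i * b ^ (2*p - 1 - Suc i))"
    by (rule sum_mono2) (use assms in auto)
  finally have 3: "(\<Sum>i<p. t i)\<^sup>2 \<le> real p * (\<Sum>i<2*p - 1. a ^ i * b ^ (2*p - 1 - Suc i))"
    using cs by (meson mult_left_mono of_nat_0_le_iff order_trans)
  have "(a ^ p - b ^ p)\<^sup>2 = (a - b)\<^sup>2 * (\<Sum>i<p. t i)\<^sup>2"
    by (simp add: 1 power_mult_distrib)
  also have "\<dots> \<le> (a - b)\<^sup>2 * (real p * (\<Sum>i<2*p - 1. a ^ i * b ^ (2*p - 1 - Suc i)))"
    using 3 by (intro mult_left_mono) auto
  finally show ?thesis
    unfolding 2 by (simp only: power2_eq_square mult_ac)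
qed

text \<open>
  Edges are pairs of darts, and \<open>q\<close> sends a dart to its vertex, so that multiple edges and loops are
  allowed. In the application \<open>w\<close> is the norm of a section and \<open>c x y\<close> the real part of the scalar
  product of its value at \<open>q x\<close> with the transported value from \<open>q y\<close>.
\<close>

locale subsolution_graph =
  fixes V :: "'v set" and E :: "('d \<times> 'd) set" and q :: "'d \<Rightarrow> 'v"
    and w :: "'v \<Rightarrow> real" and c :: "'d \<Rightarrow> 'd \<Rightarrow> real" and \<mu> :: real
  assumes fin_V: "finite V" and fin_E: "finite E"
    and edge_sym: "(x, y) \<in> E \<Longrightarrow> (y, x) \<in> E"
    and edge_V: "(x, y) \<in> E \<Longrightarrow> q x \<in> V"
    and w_nonneg: "w v \<ge> 0"
    and c_sym: "(x, y) \<in> E \<Longrightarrow> c y x = c x y"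
    and c_bound: "(x, y) \<in> E \<Longrightarrow> \<bar>c x y\<bar> \<le> w (q x) * w (q y)"
    and mu_nonneg: "\<mu> \<ge> 0"
    and subsolution: "v \<in> V \<Longrightarrow>
      (\<Sum>(x, y) | (x, y) \<in> E \<and> q x = v. (w v)\<^sup>2 - c x y) \<le> \<mu> * (w v)\<^sup>2"
begin

definition jump :: "'d \<Rightarrow> 'd \<Rightarrow> real" where
  "jump x y = sqrt ((w (q x))\<^sup>2 + (w (q y))\<^sup>2 - 2 * c x y)"

lemma jump_nonneg: "(x, y) \<in> E \<Longrightarrow> jump x y \<ge> 0"
  and jump_squared: "(x, y) \<in> E \<Longrightarrow> (jump x y)\<^sup>2 = (w (q x))\<^sup>2 + (w (q y))\<^sup>2 - 2 * c x y"
proof -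
  assume "(x, y) \<in> E"
  then have "2 * c x y \<le> 2 * (w (q x) * w (q y))" using c_bound by fastforce
  also have "\<dots> \<le> (w (q x))\<^sup>2 + (w (q y))\<^sup>2"
    using sum_squares_bound[of "w (q x)" "w (q y)"] by (simp add: mult.assoc)
  finally show "jump x y \<ge> 0" "(jump x y)\<^sup>2 = (w (q x))\<^sup>2 + (w (q y))\<^sup>2 - 2 * c x y"
    unfolding jump_def by auto
qed

lemma sum_edges_swap: "(\<Sum>(x, y)\<in>E. g x y) = (\<Sum>(x, y)\<in>E. g y x :: real)"
  by (rule sum.reindex_bij_witness[of _ prod.swap prod.swap]) (auto intro: edge_sym)

text \<open>
  The inequality at \<open>v\<close> is multiplied by \<open>\<psi> v\<close> and summed. As the edges come in both orientations,
  either end of an edge may be taken as the vertex, and the symmetric form is twice that sum.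
\<close>

lemma tested_subsolution:
  assumes "\<And>v. \<psi> v \<ge> 0"
  shows "(\<Sum>(x, y)\<in>E. \<psi> (q x) * ((w (q x))\<^sup>2 - c x y) + \<psi> (q y) * ((w (q y))\<^sup>2 - c x y))
    \<le> 2 * \<mu> * (\<Sum>v\<in>V. \<psi> v * (w v)\<^sup>2)"
proof -
  define g where "g x y = \<psi> (q x) * ((w (q x))\<^sup>2 - c x y)" for x y
  have "(\<Sum>(x, y)\<in>E. \<psi> (q x) * ((w (q x))\<^sup>2 - c x y) + \<psi> (q y) * ((w (q y))\<^sup>2 - c x y))
      = (\<Sum>(x, y)\<in>E. g x y + g y x)"
    by (intro sum.cong) (auto simp: g_def c_sym)
  also have "\<dots> = 2 * (\<Sum>(x, y)\<in>E. g x y)"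
    using sum_edges_swap[of g] by (simp add: case_prod_unfold sum.distrib)
  also have "(\<Sum>(x, y)\<in>E. g x y) = (\<Sum>v\<in>V. \<Sum>e | e \<in> E \<and> q (fst e) = v. g (fst e) (snd e))"
    using fin_E fin_V edge_V by (subst sum.group) (auto simp: case_prod_unfold)
  also have "\<dots> = (\<Sum>v\<in>V. \<psi> v * (\<Sum>(x, y) | (x, y) \<in> E \<and> q x = v. (w v)\<^sup>2 - c x y))"
    unfolding sum_distrib_left by (intro sum.cong) (auto simp: g_def)
  also have "\<dots> \<le> (\<Sum>v\<in>V. \<psi> v * (\<mu> * (w v)\<^sup>2))"
    by (intro sum_mono mult_left_mono subsolution assms)
  finally show ?thesis
    by (simp add: sum_distrib_left mult_ac)
qed

lemma jump_energy: "(\<Sum>(x, y)\<in>E. (jump x y)\<^sup>2) \<le> 2 * \<mu> * (\<Sum>v\<in>V. (w v)\<^sup>2)"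
proof -
  have "(\<Sum>(x, y)\<in>E. (jump x y)\<^sup>2)
      = (\<Sum>(x, y)\<in>E. 1 * ((w (q x))\<^sup>2 - c x y) + 1 * ((w (q y))\<^sup>2 - c x y))"
    by (intro sum.cong) (auto simp: jump_squared)
  also have "\<dots> \<le> 2 * \<mu> * (\<Sum>v\<in>V. 1 * (w v)\<^sup>2)"
    by (rule tested_subsolution) simp
  finally show ?thesis by simp
qed

text \<open>
  The test function is \<open>w\<^bsup>2p-2\<^esup>\<close>. By \<open>c \<le> w\<^sub>x w\<^sub>y\<close> the contribution of an edge is at least
  \<open>(w\<^sub>x - w\<^sub>y) (w\<^sub>x\<^bsup>2p-1\<^esup> - w\<^sub>y\<^bsup>2p-1\<^esup>)\<close>, as for a nonnegative scalar subsolution: this is Kato's inequality.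
\<close>

lemma power_energy:
  assumes "p \<ge> 1"
  shows "(\<Sum>(x, y)\<in>E. (w (q x) ^ p - w (q y) ^ p)\<^sup>2) \<le> 2 * p * \<mu> * (\<Sum>v\<in>V. w v ^ (2 * p))"
proof -
  obtain m where p: "p = Suc m" using assms by (cases p) auto
  have "(\<Sum>(x, y)\<in>E. (w (q x) ^ p - w (q y) ^ p)\<^sup>2)
      \<le> (\<Sum>(x, y)\<in>E. p * (w (q x) ^ (2*m) * ((w (q x))\<^sup>2 - c x y)
                          + w (q y) ^ (2*m) * ((w (q y))\<^sup>2 - c x y)))"
  proof (intro sum_mono, clarify)
    fix x y assume e: "(x, y) \<in> E"
    define a b where "a = w (q x)" and "b = w (q y)"
    have nn: "a \<ge> 0" "b \<ge> 0" by (auto simp: a_def b_def w_nonneg)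
    have cb: "c x y \<le> a * b" using c_bound[OF e] by (simp add: a_def b_def)
    have "(a ^ p - b ^ p)\<^sup>2 \<le> real p * ((a - b) * (a ^ (2 * p - 1) - b ^ (2 * p - 1)))"
      using nn assms by (rule power_diff_squared_le)
    also have "(a - b) * (a ^ (2 * p - 1) - b ^ (2 * p - 1))
        = a ^ (2*m) * (a\<^sup>2 - a * b) + b ^ (2*m) * (b\<^sup>2 - a * b)"
      by (simp add: p algebra_simps power2_eq_square)
    also have "\<dots> \<le> a ^ (2*m) * (a\<^sup>2 - c x y) + b ^ (2*m) * (b\<^sup>2 - c x y)"
      by (intro add_mono mult_left_mono) (use nn cb in auto)
    finally show "(w (q x) ^ p - w (q y) ^ p)\<^sup>2 \<le> p * (w (q x) ^ (2*m) * ((w (q x))\<^sup>2 - c x y)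
        + w (q y) ^ (2*m) * ((w (q y))\<^sup>2 - c x y))"
      by (simp add: a_def b_def mult_left_mono)
  qed
  also have "\<dots> = p * (\<Sum>(x, y)\<in>E. w (q x) ^ (2*m) * ((w (q x))\<^sup>2 - c x y)
                          + w (q y) ^ (2*m) * ((w (q y))\<^sup>2 - c x y))"
    by (simp add: sum_distrib_left case_prod_unfold)
  also have "\<dots> \<le> p * (2 * \<mu> * (\<Sum>v\<in>V. w v ^ (2*m) * (w v)\<^sup>2))"
    by (intro mult_left_mono tested_subsolution) (auto simp: w_nonneg)
  also have "(\<Sum>v\<in>V. w v ^ (2*m) * (w v)\<^sup>2) = (\<Sum>v\<in>V. w v ^ (2 * p))"
    by (simp add: p power_add mult_ac power2_eq_square)
  finally show ?thesis by (simp add: mult_ac)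
qed

text \<open>
  The product rule: on an edge, the tested expression is \<open>\<psi>\<^sub>x d\<^sup>2 - (\<psi>\<^sub>x - \<psi>\<^sub>y) (w\<^sub>y\<^sup>2 - c)\<close>. The second factor
  stands for \<open>- Re \<langle>d, \<phi> f y\<rangle>\<close>, and \<open>\<bar>w\<^sub>y\<^sup>2 - c\<bar> \<le> d w\<^sub>y\<close> is equivalent to \<open>c\<^sup>2 \<le> w\<^sub>x\<^sup>2 w\<^sub>y\<^sup>2\<close>.
\<close>

lemma localized_jump_energy:
  assumes "\<And>v. \<psi> v \<ge> 0"
  shows "(\<Sum>(x, y)\<in>E. \<psi> (q x) * (jump x y)\<^sup>2)
    \<le> 2 * \<mu> * (\<Sum>v\<in>V. \<psi> v * (w v)\<^sup>2)
      + (\<Sum>(x, y)\<in>E. \<bar>\<psi> (q x) - \<psi> (q y)\<bar> * (jump x y * w (q y)))"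
proof -
  have "(\<Sum>(x, y)\<in>E. \<psi> (q x) * (jump x y)\<^sup>2)
    \<le> (\<Sum>(x, y)\<in>E. (\<psi> (q x) * ((w (q x))\<^sup>2 - c x y) + \<psi> (q y) * ((w (q y))\<^sup>2 - c x y))
        + \<bar>\<psi> (q x) - \<psi> (q y)\<bar> * (jump x y * w (q y)))"
  proof (intro sum_mono, clarify)
    fix x y assume e: "(x, y) \<in> E"
    define a b where "a = w (q x)" and "b = w (q y)"
    define D where "D = jump x y"
    have D: "D \<ge> 0" "D\<^sup>2 = a\<^sup>2 + b\<^sup>2 - 2 * c x y"
      using jump_nonneg[OF e] jump_squared[OF e] by (auto simp: a_def b_def D_def)
    have nn: "a \<ge> 0" "b \<ge> 0" by (auto simp: a_def b_def w_nonneg)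
    have "\<bar>c x y\<bar>\<^sup>2 \<le> (a * b)\<^sup>2"
      using c_bound[OF e] by (intro power_mono) (auto simp: a_def b_def)
    moreover have "(D * b)\<^sup>2 = (a\<^sup>2 + b\<^sup>2 - 2 * c x y) * b\<^sup>2"
      by (simp add: power_mult_distrib D)
    ultimately have "(b\<^sup>2 - c x y)\<^sup>2 \<le> (D * b)\<^sup>2"
      by (simp add: algebra_simps power2_eq_square)
    then have "\<bar>b\<^sup>2 - c x y\<bar> \<le> D * b"
      using D nn abs_le_square_iff[of "b\<^sup>2 - c x y" "D * b"] by simp
    then have "\<bar>\<psi> (q x) - \<psi> (q y)\<bar> * \<bar>b\<^sup>2 - c x y\<bar> \<le> \<bar>\<psi> (q x) - \<psi> (q y)\<bar> * (D * b)"
      by (intro mult_left_mono) auto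
    then have "(\<psi> (q x) - \<psi> (q y)) * (b\<^sup>2 - c x y) \<le> \<bar>\<psi> (q x) - \<psi> (q y)\<bar> * (D * b)"
      unfolding abs_mult[symmetric] by linarith
    moreover have "\<psi> (q x) * D\<^sup>2 = \<psi> (q x) * (a\<^sup>2 - c x y) + \<psi> (q y) * (b\<^sup>2 - c x y)
        + (\<psi> (q x) - \<psi> (q y)) * (b\<^sup>2 - c x y)"
      by (simp add: D algebra_simps)
    ultimately show "\<psi> (q x) * (jump x y)\<^sup>2 \<le> \<psi> (q x) * ((w (q x))\<^sup>2 - c x y)
        + \<psi> (q y) * ((w (q y))\<^sup>2 - c x y) + \<bar>\<psi> (q x) - \<psi> (q y)\<bar> * (jump x y * w (q y))"
      unfolding a_def b_def D_def by linarith
  qed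
  also have "\<dots> \<le> 2 * \<mu> * (\<Sum>v\<in>V. \<psi> v * (w v)\<^sup>2)
      + (\<Sum>(x, y)\<in>E. \<bar>\<psi> (q x) - \<psi> (q y)\<bar> * (jump x y * w (q y)))"
    using tested_subsolution[of \<psi>] assms by (simp add: sum.distrib case_prod_unfold)
  finally show ?thesis .
qed

text \<open>
  Moser iteration. Let \<open>A k\<close> be the mean of \<open>w\<close> raised to the power \<open>2\<^sup>k\<close>. The Sobolev inequality for
  \<open>w\<^sup>p\<close>, \<open>p = 2\<^bsup>k-1\<^esup>\<close>, together with \<open>power_energy\<close> yields \<open>A (k+1) \<le> D 2\<^sup>k (A k)\<^sup>2\<close>. The growing factor \<open>2\<^sup>k\<close>
  is harmless, because \<open>D 2\<^bsup>k+1\<^esup> A k\<close> is at most squared in each step. A value of \<open>w\<^sup>2\<close> above the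
  bound would therefore make \<open>A k\<close> grow too fast.
\<close>

lemma sup_bound:
  assumes N: "N \<ge> 1" and mass: "(\<Sum>v\<in>V. (w v)\<^sup>2) = N" and mu: "\<mu> = L / N"
    and sobolev: "\<And>u :: 'v \<Rightarrow> real. (\<Sum>v\<in>V. (u v) ^ 4)
      \<le> 8 * (\<Sum>v\<in>V. (u v)\<^sup>2) * ((\<Sum>(x, y)\<in>E. (u (q x) - u (q y))\<^sup>2) + (\<Sum>v\<in>V. (u v)\<^sup>2) / N)"
    and v: "v \<in> V"
  shows "(w v)\<^sup>2 \<le> 32 * (L + 1)"
proof -
  have L: "L \<ge> 0" using mu mu_nonneg N by (simp add: zero_le_divide_iff)
  define D where "D = 8 * (L + 1)"
  have D: "D > 0" "D \<ge> 1" using L by (auto simp: D_def)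
  define A where "A k = (\<Sum>v\<in>V. w v ^ (2 ^ k)) / N" for k
  have A_nonneg: "A k \<ge> 0" for k using N by (auto simp: A_def w_nonneg intro!: sum_nonneg divide_nonneg_nonneg)
  have step: "A (Suc k) \<le> D * 2 ^ k * (A k)\<^sup>2" if "k \<ge> 1" for k
  proof -
    obtain j where k: "k = Suc j" using \<open>k \<ge> 1\<close> by (cases k) auto
    define p :: nat where "p = 2 ^ j"
    have p: "p \<ge> 1" "2 ^ k = 2 * p" "2 ^ Suc k = 4 * p" by (auto simp: p_def k)
    define S where "S = (\<Sum>v\<in>V. w v ^ (2 * p))"
    have S: "S \<ge> 0" unfolding S_def by (auto intro!: sum_nonneg simp: w_nonneg)
    have "(\<Sum>v\<in>V. w v ^ (4 * p)) = (\<Sum>v\<in>V. (w v ^ p) ^ 4)"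
      by (simp add: mult.commute flip: power_mult)
    also have "\<dots> \<le> 8 * (\<Sum>v\<in>V. (w v ^ p)\<^sup>2)
        * ((\<Sum>(x, y)\<in>E. (w (q x) ^ p - w (q y) ^ p)\<^sup>2) + (\<Sum>v\<in>V. (w v ^ p)\<^sup>2) / N)"
      by (rule sobolev)
    also have "(\<Sum>v\<in>V. (w v ^ p)\<^sup>2) = S"
      by (simp add: S_def mult.commute flip: power_mult)
    also have "8 * S * ((\<Sum>(x, y)\<in>E. (w (q x) ^ p - w (q y) ^ p)\<^sup>2) + S / N)
        \<le> 8 * S * (2 * p * \<mu> * S + S / N)"
      using power_energy[OF p(1)] S by (intro mult_left_mono add_mono) (auto simp: S_def)
    also have "\<dots> = 8 * (2 * p * L + 1) * S\<^sup>2 / N"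
      using N by (simp add: mu field_simps power2_eq_square)
    also have "\<dots> \<le> 8 * (2 * p * (L + 1)) * S\<^sup>2 / N"
      using N p by (intro divide_right_mono mult_right_mono) (auto simp: algebra_simps)
    finally have "(\<Sum>v\<in>V. w v ^ (4 * p)) \<le> D * (2 * p) * S\<^sup>2 / N" by (simp add: D_def mult_ac)
    then have "(\<Sum>v\<in>V. w v ^ (4 * p)) / N \<le> D * (2 * p) * (S / N)\<^sup>2"
      using N by (simp add: field_simps power2_eq_square)
    moreover have "(2::real) ^ k = 2 * real p" using p(2) by (metis of_nat_mult of_nat_numeral of_nat_power)
    ultimately show ?thesis unfolding A_def p S_def by simp
  qed
  \<comment> \<open>This normalization absorbs the factor \<open>2\<^sup>k\<close> of the recursion exactly.\<close>
  have geom: "D * 2 ^ (k + 2) * A (Suc k) \<le> (4 * D) ^ (2 ^ k)" for k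
  proof (induction k)
    case 0
    show ?case using mass N by (simp add: A_def)
  next
    case (Suc k)
    have "D * 2 ^ (Suc k + 2) * A (Suc (Suc k)) \<le> D * 2 ^ (Suc k + 2) * (D * 2 ^ Suc k * (A (Suc k))\<^sup>2)"
      using D by (intro mult_left_mono step) auto
    also have "\<dots> = (D * 2 ^ (k + 2) * A (Suc k))\<^sup>2"
      by (simp add: power2_eq_square)
    also have "\<dots> \<le> ((4 * D) ^ (2 ^ k))\<^sup>2"
      using Suc D A_nonneg by (intro power_mono) auto
    also have "\<dots> = (4 * D) ^ (2 ^ Suc k)" by (simp only: power_Suc mult.commute[of 2] power_mult)
    finally show ?case .
  qed
  have bound: "((w v)\<^sup>2 / (4 * D)) ^ (2 ^ k) \<le> N" for k
  proof -
    have "((w v)\<^sup>2) ^ (2 ^ k) = w v ^ (2 ^ Suc k)" by (simp flip: power_mult)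
    also have "\<dots> \<le> (\<Sum>v\<in>V. w v ^ (2 ^ Suc k))"
      using v fin_V by (intro member_le_sum) (auto simp: w_nonneg)
    also have "\<dots> = N * A (Suc k)" using N by (simp add: A_def)
    also have "\<dots> \<le> N * (D * 2 ^ (k + 2) * A (Suc k))"
    proof (intro mult_left_mono)
      have "1 * 1 \<le> D * 2 ^ (k + 2)" using D by (intro mult_mono one_le_power) auto
      then show "A (Suc k) \<le> D * 2 ^ (k + 2) * A (Suc k)"
        using mult_right_mono[OF _ A_nonneg] by fastforce
    qed (use N in auto)
    also have "\<dots> \<le> N * (4 * D) ^ (2 ^ k)" using geom N by (intro mult_left_mono) auto
    finally show ?thesis using D by (simp add: power_divide field_simps)
  qed
  have "(w v)\<^sup>2 / (4 * D) \<le> 1"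
  proof (rule ccontr)
    assume *: "\<not> ?thesis"
    then obtain m where m: "N < ((w v)\<^sup>2 / (4 * D)) ^ m"
      using real_arch_pow[of "(w v)\<^sup>2 / (4 * D)" N] by auto
    also have "\<dots> \<le> ((w v)\<^sup>2 / (4 * D)) ^ (2 ^ m)"
      using * by (intro power_increasing) (auto simp: less_imp_le)
    finally show False using bound[of m] by simp
  qed
  then show ?thesis using D by (simp add: D_def)
qed

text \<open>
  The function \<open>D\<close> is the distance from the edge in question, in units of the mesh. The cutoff at
  scale \<open>s\<close> varies by at most \<open>2/s\<close> along an edge, and only on the \<open>O(s\<^sup>2)\<close> edges of an annulus, so its
  energy is bounded independently of \<open>s\<close>. The annuli for the scales \<open>4, \<dots>, 4\<^sup>K\<close> are disjoint, and the scale is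
  chosen by the pigeonhole principle so that its annulus carries little energy.
\<close>

lemma jump_estimate:
  fixes D :: "'v \<Rightarrow> real" and B C L M :: real
  assumes mass: "\<mu> * (\<Sum>v\<in>V. (w v)\<^sup>2) \<le> L"
    and sup: "\<And>v. v \<in> V \<Longrightarrow> w v \<le> M"
    and lip: "\<And>x y. (x, y) \<in> E \<Longrightarrow> \<bar>D (q x) - D (q y)\<bar> \<le> 2"
    and vol: "\<And>r :: real. r \<ge> 1 \<Longrightarrow> card {v \<in> V. D v \<le> r} \<le> C * r\<^sup>2"
    and edge_vol: "\<And>r :: real. r \<ge> 1 \<Longrightarrow> card {(x, y) \<in> E. D (q x) \<le> r} \<le> B * r\<^sup>2"
    and e0: "(x0, y0) \<in> E" "D (q x0) \<le> 0"
    and K: "K \<ge> 1"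
  shows "(jump x0 y0)\<^sup>2 \<le> 2 * \<mu> * M\<^sup>2 * (C * (2 * 4 ^ K)\<^sup>2) + 8 * M * sqrt (2 * B * L / K)"
proof -
  define s :: "nat \<Rightarrow> real" where "s k = 4 ^ Suc k" for k
  \<comment> \<open>The margins of width \<open>2\<close> account for the change of \<open>D\<close> along an edge.\<close>
  define \<A> where "\<A> k = {(x, y) \<in> E. s k - 2 < D (q x) \<and> D (q x) < 2 * s k + 2}" for k
  define J where "J e = (jump (fst e) (snd e))\<^sup>2" for e
  have s_ge: "s k \<ge> 4" for k by (simp add: s_def)
  have s_step: "2 * s k + 2 \<le> s l - 2" if "k < l" for k l
  proof -
    have "4 * s k = s (Suc k)" by (simp add: s_def)
    also have "\<dots> \<le> s l" using that unfolding s_def by (intro power_increasing) auto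
    finally show ?thesis using s_ge[of k] by linarith
  qed
  have M: "M \<ge> 0" using sup[OF edge_V[OF e0(1)]] w_nonneg order_trans by blast
  have fin_\<A>: "finite (\<A> k)" for k
    unfolding \<A>_def by (rule finite_subset[OF _ fin_E]) auto
  have disj: "\<A> k \<inter> \<A> l = {}" if "k \<noteq> l" for k l
    using that s_step[of k l] s_step[of l k] unfolding \<A>_def by (cases k l rule: linorder_cases) fastforce+
  have "(\<Sum>k<K. sum J (\<A> k)) = sum J (\<Union>k<K. \<A> k)"
    using fin_\<A> disj by (subst sum.UNION_disjoint) auto
  also have "\<dots> \<le> sum J E"
    by (rule sum_mono2[OF fin_E]) (auto simp: \<A>_def J_def)
  also have "\<dots> \<le> 2 * L"
    using jump_energy mass by (simp add: J_def case_prod_unfold)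
  finally have total: "(\<Sum>k<K. sum J (\<A> k)) \<le> 2 * L" .
  have "\<exists>k<K. sum J (\<A> k) \<le> 2 * L / K"
  proof (rule ccontr)
    assume "\<not> ?thesis"
    then have "(\<Sum>k<K. 2 * L / K) < (\<Sum>k<K. sum J (\<A> k))"
      using K by (intro sum_strict_mono) (auto simp: not_le lessThan_empty_iff)
    then show False using total K by simp
  qed
  then obtain k where k: "k < K" "sum J (\<A> k) \<le> 2 * L / K" by blast
  define \<psi> where "\<psi> v = max 0 (min 1 (2 - D v / s k))" for v
  have \<psi>: "\<psi> v \<ge> 0" "\<psi> v \<le> 1" for v by (auto simp: \<psi>_def)
  have "2 * \<mu> * (\<Sum>v\<in>V. \<psi> v * (w v)\<^sup>2) \<le> 2 * \<mu> * (M\<^sup>2 * (C * (2 * 4 ^ K)\<^sup>2))"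
  proof (intro mult_left_mono)
    have "(\<Sum>v\<in>V. \<psi> v * (w v)\<^sup>2) \<le> (\<Sum>v\<in>V. if D v \<le> 2 * s k then M\<^sup>2 else 0)"
    proof (intro sum_mono)
      fix v assume "v \<in> V"
      then have "\<psi> v * (w v)\<^sup>2 \<le> 1 * M\<^sup>2"
        using \<psi> sup w_nonneg by (intro mult_mono power_mono) auto
      moreover have "\<psi> v = 0" if "D v > 2 * s k"
        using that s_ge[of k] by (simp add: \<psi>_def field_simps)
      ultimately show "\<psi> v * (w v)\<^sup>2 \<le> (if D v \<le> 2 * s k then M\<^sup>2 else 0)" by auto
    qed
    also have "\<dots> = M\<^sup>2 * card {v \<in> V. D v \<le> 2 * s k}"
      by (simp add: sum.inter_filter[OF fin_V, symmetric])
    also have "\<dots> \<le> M\<^sup>2 * card {v \<in> V. D v \<le> 2 * 4 ^ K}"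
    proof (intro mult_left_mono of_nat_mono card_mono)
      have "s k \<le> 4 ^ K" using k unfolding s_def by (intro power_increasing) auto
      then show "{v \<in> V. D v \<le> 2 * s k} \<subseteq> {v \<in> V. D v \<le> 2 * 4 ^ K}" by auto
    qed (use fin_V in auto)
    also have "\<dots> \<le> M\<^sup>2 * (C * (2 * 4 ^ K)\<^sup>2)"
    proof (rule mult_left_mono[OF vol])
      have "(1::real) \<le> 4 ^ K" by simp
      then show "(1::real) \<le> 2 * 4 ^ K" by linarith
    qed auto
    finally show "(\<Sum>v\<in>V. \<psi> v * (w v)\<^sup>2) \<le> M\<^sup>2 * (C * (2 * 4 ^ K)\<^sup>2)" .
  qed (use mu_nonneg in auto)
  moreover have "(\<Sum>(x, y)\<in>E. \<bar>\<psi> (q x) - \<psi> (q y)\<bar> * (jump x y * w (q y)))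
      \<le> 8 * M * sqrt (2 * B * L / K)"
  proof -
    have "(\<Sum>(x, y)\<in>E. \<bar>\<psi> (q x) - \<psi> (q y)\<bar> * (jump x y * w (q y)))
        = (\<Sum>(x, y)\<in>\<A> k. \<bar>\<psi> (q x) - \<psi> (q y)\<bar> * (jump x y * w (q y)))"
    proof (intro sum.mono_neutral_right fin_E ballI)
      fix e assume "e \<in> E - \<A> k"
      then obtain x y where e: "e = (x, y)" "(x, y) \<in> E"
        and "D (q x) \<le> s k - 2 \<or> D (q x) \<ge> 2 * s k + 2"
        by (cases e) (force simp: \<A>_def)
      then have "D (q x) \<le> s k \<and> D (q y) \<le> s k \<or> D (q x) \<ge> 2 * s k \<and> D (q y) \<ge> 2 * s k"
        using lip[OF e(2)] by linarith
      then have "\<psi> (q x) = \<psi> (q y)"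
        using s_ge[of k] by (auto simp: \<psi>_def max_def min_def field_simps)
      then show "(case e of (x, y) \<Rightarrow> \<bar>\<psi> (q x) - \<psi> (q y)\<bar> * (jump x y * w (q y))) = 0"
        by (simp add: e)
    qed (auto simp: \<A>_def)
    also have "\<dots> \<le> (\<Sum>(x, y)\<in>\<A> k. 2 / s k * (jump x y * M))"
    proof (intro sum_mono, clarify)
      fix x y assume "(x, y) \<in> \<A> k"
      then have e: "(x, y) \<in> E" by (auto simp: \<A>_def)
      have "\<bar>\<psi> (q x) - \<psi> (q y)\<bar> \<le> \<bar>D (q x) / s k - D (q y) / s k\<bar>"
        unfolding \<psi>_def by linarith
      also have "\<dots> = \<bar>D (q x) - D (q y)\<bar> / s k"
        using s_ge[of k] by (simp flip: diff_divide_distrib)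
      also have "\<dots> \<le> 2 / s k"
        using lip[OF e] s_ge[of k] by (intro divide_right_mono) auto
      finally show "\<bar>\<psi> (q x) - \<psi> (q y)\<bar> * (jump x y * w (q y)) \<le> 2 / s k * (jump x y * M)"
        using jump_nonneg[OF e] w_nonneg sup[OF edge_V[OF edge_sym[OF e]]] s_ge[of k]
        by (intro mult_mono) auto
    qed
    also have "\<dots> = 2 * M / s k * (\<Sum>(x, y)\<in>\<A> k. jump x y)"
      by (simp add: sum_distrib_left case_prod_unfold mult_ac)
    also have "(\<Sum>(x, y)\<in>\<A> k. jump x y) \<le> sqrt (card (\<A> k) * sum J (\<A> k))"
    proof -
      have "(\<Sum>(x, y)\<in>\<A> k. jump x y)\<^sup>2 \<le> sum J (\<A> k) * card (\<A> k)"
        using sum_squared_le_sum_of_squares[of "\<lambda>e. jump (fst e) (snd e)" "\<A> k"]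
        by (simp add: J_def case_prod_unfold mult.commute)
      then show ?thesis by (intro real_le_rsqrt) (simp add: mult.commute)
    qed
    also have "sqrt (card (\<A> k) * sum J (\<A> k)) \<le> sqrt ((B * (4 * s k)\<^sup>2) * (2 * L / K))"
    proof (intro real_sqrt_le_mono mult_mono k)
      have "real (card (\<A> k)) \<le> card {(x, y) \<in> E. D (q x) \<le> 4 * s k}"
        using s_ge[of k]
        by (intro of_nat_mono card_mono finite_subset[OF _ fin_E]) (auto simp: \<A>_def)
      also have "\<dots> \<le> B * (4 * s k)\<^sup>2" using s_ge[of k] by (intro edge_vol) auto
      finally show "card (\<A> k) \<le> B * (4 * s k)\<^sup>2" .
      then show "0 \<le> B * (4 * s k)\<^sup>2" by linarith
    qed (auto simp: J_def intro!: sum_nonneg)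
    also have "(B * (4 * s k)\<^sup>2) * (2 * L / K) = (4 * s k)\<^sup>2 * (2 * B * L / K)"
      by simp
    also have "sqrt \<dots> = 4 * s k * sqrt (2 * B * L / K)"
      using s_ge[of k] by (subst real_sqrt_mult, subst real_sqrt_abs) simp
    finally have "(\<Sum>(x, y)\<in>E. \<bar>\<psi> (q x) - \<psi> (q y)\<bar> * (jump x y * w (q y)))
        \<le> 2 * M / s k * (4 * s k * sqrt (2 * B * L / K))"
      using M s_ge[of k] by (simp add: divide_right_mono mult_left_mono)
    then show ?thesis
      using s_ge[of k] by (simp add: mult_ac)
  qed
  moreover have "(jump x0 y0)\<^sup>2 \<le> (\<Sum>(x, y)\<in>E. \<psi> (q x) * (jump x y)\<^sup>2)"
  proof -
    have "D (q x0) / s k \<le> 0" using e0(2) s_ge[of k] by (simp add: divide_nonpos_pos)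
    then have "\<psi> (q x0) = 1" by (simp add: \<psi>_def)
    then show ?thesis
      using member_le_sum[OF e0(1), of "\<lambda>(x, y). \<psi> (q x) * (jump x y)\<^sup>2"] \<psi> fin_E by auto
  qed
  ultimately show ?thesis
    using localized_jump_energy[of \<psi>] \<psi> by (simp add: mult_ac)
qed

end

section \<open>A Sobolev inequality on square grids\<close>

lemma abs_diff_le_total_variation:
  fixes g :: "nat \<Rightarrow> real"
  assumes "a < n" "b < n"
  shows "\<bar>g a - g b\<bar> \<le> (\<Sum>k<n - 1. \<bar>g (Suc k) - g k\<bar>)"
  using assms
proof (induction a b rule: linorder_wlog)
  case (le a b)
  have "\<bar>g b - g a\<bar> = \<bar>\<Sum>k\<in>{a..<b}. g (Suc k) - g k\<bar>"
    using le by (simp add: sum_Suc_diff')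
  also have "\<dots> \<le> (\<Sum>k\<in>{a..<b}. \<bar>g (Suc k) - g k\<bar>)"
    by (rule sum_abs)
  also have "\<dots> \<le> (\<Sum>k<n - 1. \<bar>g (Suc k) - g k\<bar>)"
    using le by (intro sum_mono2) auto
  finally show ?case by (simp add: abs_minus_commute)
qed (simp add: abs_minus_commute)

lemma value_le_mean_plus_total_variation:
  fixes g :: "nat \<Rightarrow> real"
  assumes "a < n"
  shows "g a \<le> (\<Sum>k<n. g k) / n + (\<Sum>k<n - 1. \<bar>g (Suc k) - g k\<bar>)"
proof -
  define T where "T = (\<Sum>k<n - 1. \<bar>g (Suc k) - g k\<bar>)"
  have "(\<Sum>k<n. g a) \<le> (\<Sum>k<n. g k + T)"
    using abs_diff_le_total_variation[OF assms, of _ g]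
    by (intro sum_mono) (fastforce simp: T_def abs_le_iff)
  then show ?thesis
    using assms by (simp add: sum.distrib T_def field_simps)
qed

text \<open>
  The gradient of a square: \<open>\<bar>f\<^sup>2 - g\<^sup>2\<bar> = \<bar>f - g\<bar> \<bar>f + g\<bar>\<close>, followed by Cauchy-Schwarz.
\<close>

lemma sum_abs_diff_squares_le:
  fixes f g :: "'b \<Rightarrow> real"
  assumes "finite A" "(\<Sum>a\<in>A. (f a)\<^sup>2) \<le> S" "(\<Sum>a\<in>A. (g a)\<^sup>2) \<le> S"
    and "(\<Sum>a\<in>A. (f a - g a)\<^sup>2) \<le> R"
  shows "(\<Sum>a\<in>A. \<bar>(f a)\<^sup>2 - (g a)\<^sup>2\<bar>) \<le> 2 * sqrt (R * S)"
proof -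
  have nn: "0 \<le> S" "0 \<le> R"
    using sum_nonneg[of A "\<lambda>a. (f a)\<^sup>2"] sum_nonneg[of A "\<lambda>a. (f a - g a)\<^sup>2"] assms by force+
  have "(\<Sum>a\<in>A. \<bar>(f a)\<^sup>2 - (g a)\<^sup>2\<bar>)\<^sup>2 = (\<Sum>a\<in>A. \<bar>f a - g a\<bar> * \<bar>f a + g a\<bar>)\<^sup>2"
    by (simp add: power2_eq_square square_diff_square_factored abs_mult mult.commute)
  also have "\<dots> \<le> (\<Sum>a\<in>A. \<bar>f a - g a\<bar>\<^sup>2) * (\<Sum>a\<in>A. \<bar>f a + g a\<bar>\<^sup>2)"
    by (rule Cauchy_Schwarz_ineq_sum)
  also have "\<dots> \<le> R * (4 * S)"
  proof (rule mult_mono)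
    have "(\<Sum>a\<in>A. \<bar>f a + g a\<bar>\<^sup>2) \<le> (\<Sum>a\<in>A. 2 * (f a)\<^sup>2 + 2 * (g a)\<^sup>2)"
      using sum_squares_bound by (intro sum_mono) (auto simp: power2_eq_square algebra_simps)
    also have "\<dots> \<le> 4 * S"
      using assms by (simp add: sum.distrib flip: sum_distrib_left)
    finally show "(\<Sum>a\<in>A. \<bar>f a + g a\<bar>\<^sup>2) \<le> 4 * S" .
  qed (use assms nn in \<open>auto intro!: sum_nonneg\<close>)
  finally have "(\<Sum>a\<in>A. \<bar>(f a)\<^sup>2 - (g a)\<^sup>2\<bar>) \<le> sqrt (2\<^sup>2 * (R * S))"
    by (intro real_le_rsqrt) simp
  also have "\<dots> = 2 * sqrt (R * S)" by (subst real_sqrt_mult) simp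
  finally show ?thesis .
qed

text \<open>
  Ladyzhenskaya's inequality \<open>\<parallel>u\<parallel>\<^sub>4\<^sup>4 \<le> C \<parallel>u\<parallel>\<^sub>2\<^sup>2 (\<parallel>\<nabla>u\<parallel>\<^sub>2\<^sup>2 + \<parallel>u\<parallel>\<^sub>2\<^sup>2)\<close> on a square, without boundary
  condition. The values of \<open>u\<^sup>2\<close> on a row are bounded by their mean plus their total variation,
  and so are those on a column. Hence \<open>u\<^sup>4\<close> at \<open>(a, b)\<close> is at most a function of \<open>b\<close> times a
  function of \<open>a\<close>, and the double sum factorizes.
\<close>

lemma grid_sobolev:
  fixes u :: "nat \<Rightarrow> nat \<Rightarrow> real" and n :: nat
  assumes "n \<ge> 1"
  defines "S \<equiv> \<Sum>a<n. \<Sum>b<n. (u a b)\<^sup>2"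
    and "R \<equiv> (\<Sum>a<n - 1. \<Sum>b<n. (u (Suc a) b - u a b)\<^sup>2) + (\<Sum>a<n. \<Sum>b<n - 1. (u a (Suc b) - u a b)\<^sup>2)"
  shows "(\<Sum>a<n. \<Sum>b<n. (u a b) ^ 4) \<le> 8 * S * (R + S / (real n)\<^sup>2)"
proof -
  have nn: "S \<ge> 0" "R \<ge> 0"
    unfolding S_def R_def by (auto intro!: sum_nonneg add_nonneg_nonneg)
  define f where "f b = (\<Sum>k<n. (u k b)\<^sup>2) / n + (\<Sum>k<n - 1. \<bar>(u (Suc k) b)\<^sup>2 - (u k b)\<^sup>2\<bar>)" for b
  define g where "g a = (\<Sum>k<n. (u a k)\<^sup>2) / n + (\<Sum>k<n - 1. \<bar>(u a (Suc k))\<^sup>2 - (u a k)\<^sup>2\<bar>)" for a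
  have f: "(u a b)\<^sup>2 \<le> f b" if "a < n" for a b
    using value_le_mean_plus_total_variation[OF that, of "\<lambda>a. (u a b)\<^sup>2"] by (simp add: f_def)
  have g: "(u a b)\<^sup>2 \<le> g a" if "b < n" for a b
    using value_le_mean_plus_total_variation[OF that, of "\<lambda>b. (u a b)\<^sup>2"] by (simp add: g_def)
  have f0: "f b \<ge> 0" and g0: "g a \<ge> 0" for a b
    unfolding f_def g_def by (auto intro!: sum_nonneg add_nonneg_nonneg divide_nonneg_nonneg)
  define T where "T = S / n + 2 * sqrt (R * S)"
  have T: "T \<ge> 0" using nn by (simp add: T_def)
  have "(\<Sum>b<n. \<Sum>k<n - 1. \<bar>(u (Suc k) b)\<^sup>2 - (u k b)\<^sup>2\<bar>)
      = (\<Sum>(k, b)\<in>{..<n - 1} \<times> {..<n}. \<bar>(u (Suc k) b)\<^sup>2 - (u k b)\<^sup>2\<bar>)"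
    by (subst sum.swap) (simp add: sum.cartesian_product)
  also have "\<dots> \<le> 2 * sqrt (R * S)"
    unfolding case_prod_unfold
  proof (rule sum_abs_diff_squares_le)
    have "(\<Sum>e\<in>{..<n - 1} \<times> {..<n}. (u (Suc (fst e)) (snd e))\<^sup>2)
        = (\<Sum>e\<in>{1..<n} \<times> {..<n}. (u (fst e) (snd e))\<^sup>2)"
      by (rule sum.reindex_bij_witness[of _ "\<lambda>(a, b). (a - 1, b)" "\<lambda>(a, b). (Suc a, b)"]) auto
    also have "\<dots> \<le> (\<Sum>e\<in>{..<n} \<times> {..<n}. (u (fst e) (snd e))\<^sup>2)"
      by (rule sum_mono2) auto
    finally show "(\<Sum>e\<in>{..<n - 1} \<times> {..<n}. (u (Suc (fst e)) (snd e))\<^sup>2) \<le> S"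
      by (simp add: S_def sum.cartesian_product case_prod_unfold)
    have "(\<Sum>e\<in>{..<n - 1} \<times> {..<n}. (u (fst e) (snd e))\<^sup>2)
        \<le> (\<Sum>e\<in>{..<n} \<times> {..<n}. (u (fst e) (snd e))\<^sup>2)"
      by (rule sum_mono2) auto
    then show "(\<Sum>e\<in>{..<n - 1} \<times> {..<n}. (u (fst e) (snd e))\<^sup>2) \<le> S"
      by (simp add: S_def sum.cartesian_product case_prod_unfold)
    show "(\<Sum>e\<in>{..<n - 1} \<times> {..<n}. (u (Suc (fst e)) (snd e) - u (fst e) (snd e))\<^sup>2) \<le> R"
      by (simp add: R_def sum.cartesian_product case_prod_unfold sum_nonneg)
  qed auto
  finally have sum_f: "(\<Sum>b<n. f b) \<le> T"
    unfolding f_def T_def S_def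
    by (simp add: sum.distrib sum.swap[of "\<lambda>a b. (u a b)\<^sup>2"] flip: sum_divide_distrib)
  have "(\<Sum>a<n. \<Sum>k<n - 1. \<bar>(u a (Suc k))\<^sup>2 - (u a k)\<^sup>2\<bar>)
      = (\<Sum>(a, k)\<in>{..<n} \<times> {..<n - 1}. \<bar>(u a (Suc k))\<^sup>2 - (u a k)\<^sup>2\<bar>)"
    by (simp add: sum.cartesian_product)
  also have "\<dots> \<le> 2 * sqrt (R * S)"
    unfolding case_prod_unfold
  proof (rule sum_abs_diff_squares_le)
    have "(\<Sum>e\<in>{..<n} \<times> {..<n - 1}. (u (fst e) (Suc (snd e)))\<^sup>2)
        = (\<Sum>e\<in>{..<n} \<times> {1..<n}. (u (fst e) (snd e))\<^sup>2)"
      by (rule sum.reindex_bij_witness[of _ "\<lambda>(a, b). (a, b - 1)" "\<lambda>(a, b). (a, Suc b)"]) auto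
    also have "\<dots> \<le> (\<Sum>e\<in>{..<n} \<times> {..<n}. (u (fst e) (snd e))\<^sup>2)"
      by (rule sum_mono2) auto
    finally show "(\<Sum>e\<in>{..<n} \<times> {..<n - 1}. (u (fst e) (Suc (snd e)))\<^sup>2) \<le> S"
      by (simp add: S_def sum.cartesian_product case_prod_unfold)
    have "(\<Sum>e\<in>{..<n} \<times> {..<n - 1}. (u (fst e) (snd e))\<^sup>2)
        \<le> (\<Sum>e\<in>{..<n} \<times> {..<n}. (u (fst e) (snd e))\<^sup>2)"
      by (rule sum_mono2) auto
    then show "(\<Sum>e\<in>{..<n} \<times> {..<n - 1}. (u (fst e) (snd e))\<^sup>2) \<le> S"
      by (simp add: S_def sum.cartesian_product case_prod_unfold)
    show "(\<Sum>e\<in>{..<n} \<times> {..<n - 1}. (u (fst e) (Suc (snd e)) - u (fst e) (snd e))\<^sup>2) \<le> R"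
      by (simp add: R_def sum.cartesian_product case_prod_unfold sum_nonneg)
  qed auto
  finally have sum_g: "(\<Sum>a<n. g a) \<le> T"
    unfolding g_def T_def S_def by (simp add: sum.distrib flip: sum_divide_distrib)
  have "(\<Sum>a<n. \<Sum>b<n. (u a b) ^ 4) \<le> (\<Sum>a<n. \<Sum>b<n. g a * f b)"
  proof (intro sum_mono)
    fix a b assume "a \<in> {..<n}" "b \<in> {..<n}"
    then have "(u a b)\<^sup>2 * (u a b)\<^sup>2 \<le> g a * f b"
      using f g g0 by (intro mult_mono) auto
    then show "(u a b) ^ 4 \<le> g a * f b" by (simp flip: power_add)
  qed
  also have "\<dots> = (\<Sum>a<n. g a) * (\<Sum>b<n. f b)" by (simp add: sum_product)
  also have "\<dots> \<le> T * T"
    using sum_f sum_g T f0 by (intro mult_mono sum_nonneg) auto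
  also have "T * T \<le> 2 * (S / n)\<^sup>2 + 2 * (2 * sqrt (R * S))\<^sup>2"
  proof -
    have "(x + y) * (x + y) \<le> 2 * x\<^sup>2 + 2 * y\<^sup>2" for x y :: real
      using sum_squares_bound[of x y] by (simp add: power2_eq_square algebra_simps)
    then show ?thesis unfolding T_def .
  qed
  also have "\<dots> \<le> 8 * S * (R + S / (real n)\<^sup>2)"
  proof -
    have "(2 * sqrt (R * S))\<^sup>2 = 4 * (R * S)" using nn by (simp add: power_mult_distrib)
    moreover have "(S / n)\<^sup>2 \<ge> 0" by simp
    moreover have "8 * S * (R + S / (real n)\<^sup>2) = 8 * (R * S) + 8 * (S / n)\<^sup>2"
      by (simp add: power2_eq_square algebra_simps)
    moreover have "R * S \<ge> 0" using nn by simp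
    ultimately show ?thesis by linarith
  qed
  finally show ?thesis .
qed

section \<open>Distances and ball growth on a tiled surface\<close>

text \<open>
  A Lebesgue number for the neighbourhoods on which the tile maps are isometric.
\<close>

lemma uniform_isometry_scale:
  fixes \<tau> :: "'i \<Rightarrow> real \<times> real \<Rightarrow> 'a::metric_space"
  assumes "finite I" "\<And>i. i \<in> I \<Longrightarrow> locally_isometric_on unit_square (\<tau> i)"
  obtains \<delta> where "\<delta> > 0" "\<And>i z z'. i \<in> I \<Longrightarrow> z \<in> unit_square \<Longrightarrow> z' \<in> unit_square \<Longrightarrow>
    dist z z' < \<delta> \<Longrightarrow> dist (\<tau> i z) (\<tau> i z') = dist z z'"
proof -
  have "\<exists>\<delta>>0. \<forall>z\<in>unit_square. \<forall>z'\<in>unit_square. dist z z' < \<delta> \<longrightarrow> dist (\<tau> i z) (\<tau> i z') = dist z z'"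
    if i: "i \<in> I" for i
  proof -
    define \<G> where "\<G> = {G. open G \<and> (\<forall>z\<in>unit_square \<inter> G. \<forall>z'\<in>unit_square \<inter> G. dist (\<tau> i z) (\<tau> i z') = dist z z')}"
    have "unit_square \<subseteq> \<Union>\<G>"
    proof
      fix z assume z: "z \<in> unit_square"
      obtain \<epsilon> where "\<epsilon> > 0"
        "\<forall>x\<in>unit_square \<inter> ball z \<epsilon>. \<forall>y\<in>unit_square \<inter> ball z \<epsilon>. dist (\<tau> i x) (\<tau> i y) = dist x y"
        using assms(2)[OF i] z unfolding locally_isometric_on_def by blast
      then have "ball z \<epsilon> \<in> \<G>" "z \<in> ball z \<epsilon>" by (auto simp: \<G>_def)
      then show "z \<in> \<Union>\<G>" by blast
    qed
    moreover have "compact unit_square"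
      unfolding unit_square_def by (intro compact_Times) auto
    moreover have "open G" if "G \<in> \<G>" for G using that unfolding \<G>_def by simp
    ultimately obtain \<epsilon> where \<epsilon>: "\<epsilon> > 0" "\<And>z. z \<in> unit_square \<Longrightarrow> \<exists>G\<in>\<G>. ball z \<epsilon> \<subseteq> G"
      by (metis Heine_Borel_lemma)
    show ?thesis
    proof (intro exI[of _ \<epsilon>] conjI ballI impI \<epsilon>(1))
      fix z z' assume z: "z \<in> unit_square" "z' \<in> unit_square" "dist z z' < \<epsilon>"
      then obtain G where "G \<in> \<G>" "ball z \<epsilon> \<subseteq> G" using \<epsilon> by blast
      moreover from this have "z \<in> G" "z' \<in> G" using z \<epsilon>(1) by auto
      ultimately show "dist (\<tau> i z) (\<tau> i z') = dist z z'"
        using z unfolding \<G>_def by blast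
    qed
  qed
  then obtain \<delta> where \<delta>: "\<And>i. i \<in> I \<Longrightarrow> \<delta> i > 0"
    "\<And>i z z'. i \<in> I \<Longrightarrow> z \<in> unit_square \<Longrightarrow> z' \<in> unit_square \<Longrightarrow> dist z z' < \<delta> i
      \<Longrightarrow> dist (\<tau> i z) (\<tau> i z') = dist z z'"
    by metis
  define \<delta>0 where "\<delta>0 = Min (insert 1 (\<delta> ` I))"
  have fin: "finite (insert 1 (\<delta> ` I))" using assms(1) by simp
  show ?thesis
  proof (rule that[of \<delta>0])
    show "\<delta>0 > 0" unfolding \<delta>0_def using fin \<delta>(1) by (subst Min_gr_iff) auto
    fix i z z' assume "i \<in> I" "z \<in> unit_square" "z' \<in> unit_square" "dist z z' < \<delta>0"
    moreover from \<open>i \<in> I\<close> have "\<delta>0 \<le> \<delta> i" unfolding \<delta>0_def using fin by (intro Min_le) auto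
    ultimately show "dist (\<tau> i z) (\<tau> i z') = dist z z'" using \<delta>(2)[of i z z'] by simp
  qed
qed

lemma finite_directions: "finite directions"
  and card_directions: "card directions \<le> 4"
  unfolding directions_def by (simp_all add: card_insert_le_m1)

lemma finite_darts: "finite I \<Longrightarrow> finite (darts I n)"
  unfolding darts_def by (simp add: finite_directions)

lemma finite_oriented_edges: "finite I \<Longrightarrow> finite (oriented_edges I \<tau> n)"
  by (rule finite_subset[of _ "darts I n \<times> darts I n"])
     (auto simp: oriented_edges_def finite_darts)

lemma local_center_bounds:
  assumes "x \<in> darts I n" "n \<ge> 1"
  shows "1 / (2 * real n) \<le> fst (local_center n x)" "fst (local_center n x) \<le> 1 - 1 / (2 * real n)"
    and "1 / (2 * real n) \<le> snd (local_center n x)" "snd (local_center n x) \<le> 1 - 1 / (2 * real n)"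
proof -
  obtain i a b d where x: "x = (i, a, b, d)" "a < n" "b < n"
    using assms by (auto simp: darts_def)
  have "1 / (2 * real n) \<le> (real k + 1/2) / n \<and> (real k + 1/2) / n \<le> 1 - 1 / (2 * real n)"
    if "k < n" for k
  proof -
    have "1 / (2 * real n) = (1/2) / n" "1 - 1 / (2 * real n) = (n - 1/2) / n"
      using assms by (simp_all add: field_simps)
    moreover have "(1/2) / n \<le> (real k + 1/2) / n" by (rule divide_right_mono) auto
    moreover have "(real k + 1/2) / n \<le> (n - 1/2) / n"
      using that by (intro divide_right_mono) linarith+
    ultimately show ?thesis by argo
  qed
  from this[of a] this[of b] show "1 / (2 * real n) \<le> fst (local_center n x)"
    "fst (local_center n x) \<le> 1 - 1 / (2 * real n)" "1 / (2 * real n) \<le> snd (local_center n x)"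
    "snd (local_center n x) \<le> 1 - 1 / (2 * real n)"
    using x by simp_all
qed

lemma local_center_in_unit_square:
  assumes "x \<in> darts I n" "n \<ge> 1"
  shows "local_center n x \<in> open_square" "local_center n x \<in> unit_square"
proof -
  define \<epsilon> where "\<epsilon> = 1 / (2 * real n)"
  have "\<epsilon> > 0" using assms by (simp add: \<epsilon>_def)
  then show "local_center n x \<in> open_square" "local_center n x \<in> unit_square"
    using local_center_bounds[OF assms] unfolding \<epsilon>_def[symmetric]
    by (auto simp: open_square_def unit_square_def mem_Times_iff)
qed

lemma side_near_center:
  assumes x: "x \<in> darts I n" "n \<ge> 1" and z: "z \<in> side (local_center n x) (1 / n) (dart_direction x)"
  shows "z \<in> unit_square" "dist (local_center n x) z \<le> 1 / n"
proof -
  define c where "c = local_center n x"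
  obtain d where d: "d \<in> directions" "dart_direction x = d"
    using x by (auto simp: darts_def)
  obtain s where "s \<in> {- 1/2..1/2}" and zs: "z = c + (1 / n / 2) *\<^sub>R d + (s * (1 / n)) *\<^sub>R quarter_turn d"
    using z unfolding side_def d(2) c_def by blast
  then have s: "\<bar>s\<bar> \<le> 1/2" by auto
  have sn: "\<bar>s / n\<bar> \<le> 1 / (2 * real n)"
    using s x(2) by (simp add: field_simps)
  have near: "\<bar>fst z - fst c\<bar> \<le> 1 / (2 * real n)" "\<bar>snd z - snd c\<bar> \<le> 1 / (2 * real n)"
    using d sn unfolding zs directions_def quarter_turn_def by auto
  then show "z \<in> unit_square"
    using local_center_bounds[OF x] unfolding c_def unit_square_def mem_Times_iff atLeastAtMost_iff
    by linarith
  have "dist c z \<le> dist (fst c) (fst z) + dist (snd c) (snd z)"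
    unfolding dist_prod_def by (rule sqrt_sum_squares_le_sum) auto
  also have "\<dots> \<le> 1 / (2 * real n) + 1 / (2 * real n)"
    using near by (intro add_mono) (auto simp: dist_real_def abs_minus_commute)
  finally show "dist (local_center n x) z \<le> 1 / n" by (simp add: c_def)
qed

lemma adjacent_centers_near:
  fixes \<tau> :: "'i \<Rightarrow> real \<times> real \<Rightarrow> 'a::metric_space"
  assumes iso: "\<And>i z z'. i \<in> I \<Longrightarrow> z \<in> unit_square \<Longrightarrow> z' \<in> unit_square \<Longrightarrow>
      dist z z' < \<delta> \<Longrightarrow> dist (\<tau> i z) (\<tau> i z') = dist z z'"
    and n: "n \<ge> 1" "1 / n < \<delta>" and e: "(x, y) \<in> oriented_edges I \<tau> n"
  shows "dist (center \<tau> n x) (center \<tau> n y) \<le> 2 / n"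
proof -
  have x: "x \<in> darts I n" and y: "y \<in> darts I n" and eq: "dart_side \<tau> n x = dart_side \<tau> n y"
    using e by (auto simp: oriented_edges_def)
  have close: "dist (center \<tau> n x') (\<tau> (dart_tile x') z) \<le> 1 / n"
    if "x' \<in> darts I n" "z \<in> side (local_center n x') (1 / n) (dart_direction x')" for x' z
  proof -
    have "dart_tile x' \<in> I" using that by (auto simp: darts_def)
    then show ?thesis
      using iso[of "dart_tile x'" "local_center n x'" z] side_near_center[OF that(1) n(1) that(2)]
        local_center_in_unit_square[OF that(1) n(1)] n(2) unfolding center_def by auto
  qed
  have "side (local_center n x) (1 / n) (dart_direction x) \<noteq> {}"
    unfolding side_def by auto
  \<comment> \<open>The centres are compared through a common point of the two sides; only the equality of the sides
    as sets is available, so the point may have different positions in them.\<close>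
  then obtain z where z: "z \<in> side (local_center n x) (1 / n) (dart_direction x)" by blast
  then have "\<tau> (dart_tile x) z \<in> dart_side \<tau> n y"
    unfolding eq[symmetric] unfolding dart_side_def by blast
  then obtain z' where z': "z' \<in> side (local_center n y) (1 / n) (dart_direction y)"
    "\<tau> (dart_tile x) z = \<tau> (dart_tile y) z'"
    unfolding dart_side_def by blast
  have "dist (center \<tau> n x) (center \<tau> n y)
      \<le> dist (center \<tau> n x) (\<tau> (dart_tile x) z) + dist (center \<tau> n y) (\<tau> (dart_tile y) z')"
    using z'(2) by (metis dist_triangle2)
  also have "\<dots> \<le> 1 / n + 1 / n"
    using close[OF x z] close[OF y z'(1)] by (rule add_mono)
  finally show ?thesis by simp
qed

lemma card_nat_near:
  fixes r :: real
  assumes "r \<ge> 1"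
  shows "finite {a. \<bar>real a - real a0\<bar> \<le> 2 * r}" "card {a. \<bar>real a - real a0\<bar> \<le> 2 * r} \<le> 5 * r"
proof -
  define m where "m = nat \<lfloor>2 * r\<rfloor>"
  have sub: "{a. \<bar>real a - real a0\<bar> \<le> 2 * r} \<subseteq> {a0 - m..a0 + m}"
  proof
    fix a assume "a \<in> {a. \<bar>real a - real a0\<bar> \<le> 2 * r}"
    then have "\<bar>int a - int a0\<bar> \<le> \<lfloor>2 * r\<rfloor>" by (simp add: le_floor_iff)
    then show "a \<in> {a0 - m..a0 + m}" unfolding m_def by auto
  qed
  then show "finite {a. \<bar>real a - real a0\<bar> \<le> 2 * r}" by (rule finite_subset) simp
  have "card {a. \<bar>real a - real a0\<bar> \<le> 2 * r} \<le> card {a0 - m..a0 + m}"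
    by (rule card_mono[OF _ sub]) simp
  also have "\<dots> \<le> 2 * m + 1" by simp
  finally have "real (card {a. \<bar>real a - real a0\<bar> \<le> 2 * r}) \<le> 2 * real m + 1" by linarith
  moreover have "real m \<le> 2 * r" unfolding m_def using assms by simp
  ultimately show "card {a. \<bar>real a - real a0\<bar> \<le> 2 * r} \<le> 5 * r" using assms by linarith
qed

text \<open>
  Quadratic growth of balls, uniformly in the centre, the radius and \<open>n\<close>. The square is covered by
  finitely many discs of radius \<open>\<delta>/2\<close>. If two small squares of one tile have centres in one disc, then
  the distance of their centres in the surface equals that in the plane. So their positions in the
  tile differ by at most \<open>2r\<close> in either coordinate.

  Adjacent centres are at distance at most \<open>2/n\<close>, so the case \<open>r = 2\<close> also bounds the degrees.
\<close>

lemma darts_in_ball_bound: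
  fixes \<tau> :: "'i \<Rightarrow> real \<times> real \<Rightarrow> 'a::metric_space"
  assumes fin: "finite I" and "\<delta> > 0"
    and iso: "\<And>i z z'. i \<in> I \<Longrightarrow> z \<in> unit_square \<Longrightarrow> z' \<in> unit_square \<Longrightarrow>
      dist z z' < \<delta> \<Longrightarrow> dist (\<tau> i z) (\<tau> i z') = dist z z'"
  obtains C :: real where "C > 0" "\<And>n p r. n \<ge> 1 \<Longrightarrow> r \<ge> 1 \<Longrightarrow>
    card {x \<in> darts I n. n * dist (center \<tau> n x) p \<le> r} \<le> C * r\<^sup>2"
proof -
  have "compact unit_square" unfolding unit_square_def by (intro compact_Times) auto
  then obtain Z where Z: "finite Z" "unit_square \<subseteq> (\<Union>z\<in>Z. ball z (\<delta> / 2))"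
    using \<open>\<delta> > 0\<close> unfolding compact_eq_totally_bounded by (meson half_gt_zero)
  \<comment> \<open>Each pair of a tile and a disc contributes at most \<open>(5r)\<^sup>2\<close> positions with \<open>4\<close> darts each;
    the summand \<open>1\<close> keeps \<open>C\<close> positive for empty \<open>I\<close>.\<close>
  define C :: real where "C = card (I \<times> Z) * 100 + 1"
  show ?thesis
  proof (rule that[of C])
    fix n :: nat and p :: 'a and r :: real
    assume n: "n \<ge> 1" and r: "r \<ge> 1"
    define Y where "Y i z = {x \<in> darts I n. dart_tile x = i \<and> local_center n x \<in> ball z (\<delta> / 2)
      \<and> n * dist (center \<tau> n x) p \<le> r}" for i z
    have Y: "card (Y i z) \<le> 100 * r\<^sup>2" for i z
    proof (cases "Y i z = {}")
      case False
      then obtain x0 where x0: "x0 \<in> Y i z" by blast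
      then obtain a0 b0 d0 where x0_eq: "x0 = (i, a0, b0, d0)" by (auto simp: Y_def darts_def)
      let ?A = "\<lambda>a0. {a. \<bar>real a - real a0\<bar> \<le> 2 * r}"
      have sub: "Y i z \<subseteq> {i} \<times> ?A a0 \<times> ?A b0 \<times> directions"
      proof
        fix x assume x: "x \<in> Y i z"
        then obtain a b d where x_eq: "x = (i, a, b, d)" "d \<in> directions" "i \<in> I"
          by (auto simp: Y_def darts_def)
        have "dist (local_center n x) (local_center n x0) < \<delta>"
          using x x0 by (auto simp: Y_def intro: dist_triangle_half_r)
        then have "dist (local_center n x) (local_center n x0) = dist (center \<tau> n x) (center \<tau> n x0)"
          using x x0 iso[OF x_eq(3) local_center_in_unit_square(2)[of x I n]
              local_center_in_unit_square(2)[of x0 I n]] n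
          unfolding center_def Y_def by simp
        also have "n * \<dots> \<le> n * (dist (center \<tau> n x) p + dist (center \<tau> n x0) p)"
          by (intro mult_left_mono dist_triangle2) auto
        also have "\<dots> \<le> 2 * r" using x x0 by (simp add: Y_def distrib_left)
        finally have d: "n * dist (local_center n x) (local_center n x0) \<le> 2 * r" by simp
        have "\<bar>real a - real a0\<bar> = n * dist (fst (local_center n x)) (fst (local_center n x0))"
          using n by (simp add: x_eq x0_eq dist_real_def abs_divide flip: diff_divide_distrib)
        also have "\<dots> \<le> n * dist (local_center n x) (local_center n x0)"
          by (intro mult_left_mono dist_fst_le) auto
        finally have a: "\<bar>real a - real a0\<bar> \<le> 2 * r" using d by simp
        have "\<bar>real b - real b0\<bar> = n * dist (snd (local_center n x)) (snd (local_center n x0))"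
          using n by (simp add: x_eq x0_eq dist_real_def abs_divide flip: diff_divide_distrib)
        also have "\<dots> \<le> n * dist (local_center n x) (local_center n x0)"
          by (intro mult_left_mono dist_snd_le) auto
        finally have "\<bar>real b - real b0\<bar> \<le> 2 * r" using d by simp
        with a show "x \<in> {i} \<times> ?A a0 \<times> ?A b0 \<times> directions" by (simp add: x_eq)
      qed
      have "card (Y i z) \<le> card ({i} \<times> ?A a0 \<times> ?A b0 \<times> directions)"
        using sub by (intro card_mono) (auto intro!: finite_cartesian_product card_nat_near finite_directions r)
      also have "real \<dots> = real (card (?A a0)) * (real (card (?A b0)) * real (card directions))"
        by (simp add: card_cartesian_product)
      also have "\<dots> \<le> (5 * r) * ((5 * r) * 4)"
        using r card_directions card_nat_near[OF r] by (intro mult_mono) auto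
      finally show ?thesis by (simp add: power2_eq_square)
    qed (use r in auto)
    have "{x \<in> darts I n. n * dist (center \<tau> n x) p \<le> r} \<subseteq> (\<Union>(i, z)\<in>I \<times> Z. Y i z)"
    proof
      fix x assume x: "x \<in> {x \<in> darts I n. n * dist (center \<tau> n x) p \<le> r}"
      then obtain z where "z \<in> Z" "local_center n x \<in> ball z (\<delta> / 2)"
        using Z(2) local_center_in_unit_square(2)[of x I n] n by blast
      moreover have "dart_tile x \<in> I" using x by (auto simp: darts_def)
      ultimately show "x \<in> (\<Union>(i, z)\<in>I \<times> Z. Y i z)" using x by (force simp: Y_def)
    qed
    moreover have "finite (Y i z)" for i z
      unfolding Y_def using finite_darts[OF fin] by simp
    ultimately have "card {x \<in> darts I n. n * dist (center \<tau> n x) p \<le> r} \<le> card (\<Union>(i, z)\<in>I \<times> Z. Y i z)"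
      using fin Z(1) by (intro card_mono) auto
    also have "\<dots> \<le> (\<Sum>(i, z)\<in>I \<times> Z. card (Y i z))"
      using fin Z(1) unfolding case_prod_unfold by (intro card_UN_le) auto
    also have "real \<dots> = (\<Sum>(i, z)\<in>I \<times> Z. real (card (Y i z)))" by (simp add: case_prod_unfold)
    also have "\<dots> \<le> (\<Sum>(i, z)\<in>I \<times> Z. 100 * r\<^sup>2)"
      using Y by (intro sum_mono) auto
    also have "\<dots> \<le> C * r\<^sup>2" by (simp add: C_def distrib_right case_prod_unfold)
    finally show "card {x \<in> darts I n. n * dist (center \<tau> n x) p \<le> r} \<le> C * r\<^sup>2" by simp
  qed (simp add: C_def add_nonneg_pos)
qed

section \<open>Parallel transport is unitary\<close>

lemma hermitian_product_sum_left:
  assumes "hermitian_product h"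
  shows "h (\<Sum>j\<in>A. f j) w = (\<Sum>j\<in>A. h (f j) w)"
proof -
  have "h (0 *s 0) w = 0 * h 0 w" using assms unfolding hermitian_product_def by blast
  then have "h 0 w = 0" by simp
  moreover have "h (u + v) w = h u w + h v w" for u v
    using assms unfolding hermitian_product_def by blast
  ultimately show ?thesis
    by (induction A rule: infinite_finite_induct) simp_all
qed

lemma hermitian_product_rules:
  assumes "hermitian_product h"
  shows "h (u + v) w = h u w + h v w" "h (c *s u) w = c * h u w" "h w u = cnj (h u w)"
    "h (u - v) w = h u w - h v w" "h 0 w = 0" "h (- u) w = - h u w"
    "h w (u + v) = h w u + h w v" "h w (c *s u) = cnj c * h w u" "h w (u - v) = h w u - h w v"
    "h w (- u) = - h w u"
proof -
  have 1: "\<And>u v w. h (u + v) w = h u w + h v w" "\<And>c u w. h (c *s u) w = c * h u w" "\<And>u w. h w u = cnj (h u w)"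
    using assms unfolding hermitian_product_def by blast+
  show "h (u + v) w = h u w + h v w" "h (c *s u) w = c * h u w" "h w u = cnj (h u w)" by fact+
  show 2: "h (- u) w = - h u w" for u w using 1(2)[of "-1" u w] by simp
  show 3: "h (u - v) w = h u w - h v w" for u v w using 1(1)[of u "- v" w] 2 by simp
  show "h 0 w = 0" using 1(2)[of 0 0 w] by simp
  show "h w (u + v) = h w u + h w v" "h w (c *s u) = cnj c * h w u" "h w (u - v) = h w u - h w v"
    "h w (- u) = - h w u"
    unfolding 1(3)[of w] by (simp_all add: 1(1,2) 2 3)
qed

lemma hermitian_product_sum_right:
  assumes "hermitian_product h"
  shows "h w (\<Sum>j\<in>A. f j) = (\<Sum>j\<in>A. h w (f j))"
proof -
  have "h w u = cnj (h u w)" for u by (rule hermitian_product_rules(3)[OF assms])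
  then show ?thesis by (simp only: hermitian_product_sum_left[OF assms] cnj_sum)
qed

lemma hermitian_product_matrix_expansion:
  fixes M M' :: "complex ^ 'r::finite ^ 'r"
  assumes "hermitian_product h"
  shows "h (M *v a) (M' *v b)
    = (\<Sum>j\<in>UNIV. \<Sum>k\<in>UNIV. a $ j * cnj (b $ k) * h (M *v axis j 1) (M' *v axis k 1))"
proof -
  have *: "N *v c = (\<Sum>j\<in>UNIV. c $ j *s (N *v axis j 1))" for N :: "complex ^ 'r ^ 'r" and c
  proof -
    have "(N *v axis j 1) $ i = N $ i $ j" for i j
      by (simp add: matrix_vector_mult_def axis_def if_distrib cong: if_cong)
    then show ?thesis
      by (simp add: vec_eq_iff) (simp add: matrix_vector_mult_def mult.commute)
  qed
  show ?thesis
    unfolding *[of M a] hermitian_product_sum_left[OF assms] hermitian_product_rules(2)[OF assms]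
    unfolding *[of M' b] hermitian_product_sum_right[OF assms] hermitian_product_rules(8)[OF assms]
    by (simp add: sum_distrib_left mult.assoc)
qed

lemma fibre_norm_squared:
  assumes "hermitian_product (h x)"
  shows "(fibre_norm h x u)\<^sup>2 = Re (h x u u)"
proof -
  have "u \<noteq> 0 \<longrightarrow> Re (h x u u) > 0" using assms unfolding hermitian_product_def by blast
  then have "Re (h x u u) \<ge> 0"
    using hermitian_product_rules(5)[OF assms, of u] by (cases "u = 0") auto
  then show ?thesis by (simp add: fibre_norm_def)
qed

lemma fibre_norm_nonneg:
  assumes "hermitian_product (h x)"
  shows "fibre_norm h x u \<ge> 0"
proof -
  have "0 \<le> (fibre_norm h x u)\<^sup>2" by simp
  then have "0 \<le> Re (h x u u)" unfolding fibre_norm_squared[of h x u, OF assms] .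
  then show ?thesis by (simp add: fibre_norm_def)
qed

text \<open>
  The product of a fibre varies from point to point and is not an instance of the class of inner
  product spaces. The inequality is obtained from the nonnegativity of the quadratic form
  \<open>(s, t) \<mapsto> \<bar>s u + t v\<bar>\<^sup>2\<close>.
\<close>

lemma fibre_Cauchy_Schwarz:
  assumes "hermitian_product (h x)"
  shows "\<bar>Re (h x u v)\<bar> \<le> fibre_norm h x u * fibre_norm h x v"
proof -
  define a b c where "a = fibre_norm h x u" and "b = fibre_norm h x v" and "c = Re (h x u v)"
  note rules = hermitian_product_rules[OF assms]
  have ab: "a \<ge> 0" "b \<ge> 0" using fibre_norm_nonneg[of h x, OF assms] by (auto simp: a_def b_def)
  have sq: "a\<^sup>2 = Re (h x u u)" "b\<^sup>2 = Re (h x v v)"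
    using fibre_norm_squared[of h x, OF assms] by (auto simp: a_def b_def)
  have quad: "0 \<le> s\<^sup>2 * a\<^sup>2 + 2 * s * t * c + t\<^sup>2 * b\<^sup>2" for s t :: real
  proof -
    let ?z = "complex_of_real s *s u + complex_of_real t *s v"
    have "0 \<le> (fibre_norm h x ?z)\<^sup>2" by simp
    also have "\<dots> = Re (h x ?z ?z)" by (rule fibre_norm_squared[of h x, OF assms])
    also have "h x ?z ?z = s * s * h x u u + s * t * (h x u v + h x v u) + t * t * h x v v"
      by (simp add: rules(1,2,7,8) algebra_simps)
    also have "Re \<dots> = s\<^sup>2 * a\<^sup>2 + 2 * s * t * c + t\<^sup>2 * b\<^sup>2"
      using rules(3)[of v u] by (simp add: sq[symmetric] c_def[symmetric]) (simp add: power2_eq_square algebra_simps)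
    finally show ?thesis .
  qed
  have "\<bar>c\<bar> \<le> a * b"
  proof (cases "a * b = 0")
    case False
    then have pos: "a * b > 0" using ab by (simp add: less_le)
    have "0 \<le> (a * b) * (a * b + c)" "0 \<le> (a * b) * (a * b - c)"
      using quad[of b a] quad[of b "- a"] by (simp_all add: power2_eq_square algebra_simps)
    then have "0 \<le> a * b + c" "0 \<le> a * b - c"
      using pos by (simp_all only: zero_le_mult_iff) linarith+
    then show ?thesis by linarith
  next
    case True
    have "c = 0"
    proof (rule ccontr)
      assume c: "c \<noteq> 0"
      consider "a = 0" | "b = 0" using True by auto
      then show False
      proof cases
        case 1
        have "0 \<le> 2 * (- (b\<^sup>2 + 1) / (2 * c)) * 1 * c + 1 * b\<^sup>2"
          using quad[of "- (b\<^sup>2 + 1) / (2 * c)" 1] 1 by simp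
        then show False using c by (simp add: field_simps)
      next
        case 2
        have "0 \<le> 1 * a\<^sup>2 + 2 * 1 * (- (a\<^sup>2 + 1) / (2 * c)) * c"
          using quad[of 1 "- (a\<^sup>2 + 1) / (2 * c)"] 2 by simp
        then show False using c by (simp add: field_simps)
      qed
    qed
    then show ?thesis using ab by simp
  qed
  then show ?thesis by (simp add: a_def b_def c_def)
qed

lemma parallel_alongE:
  assumes "parallel_along X \<G> \<gamma> s" "g \<in> \<G>" "\<gamma> t \<in> gdom g" "t \<in> {0..1}"
  obtains w where "((\<lambda>t. gchart g (\<gamma> t)) has_vector_derivative w) (at t within {0..1})"
    "((\<lambda>t. matrix_inv (gframe g (\<gamma> t)) *v s t) has_vector_derivative
        - (connection_form g (gchart g (\<gamma> t)) w *v (matrix_inv (gframe g (\<gamma> t)) *v s t)))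
      (at t within {0..1})"
proof -
  have "let a = (\<lambda>t. matrix_inv (gframe g (\<gamma> t)) *v s t)
      in \<exists>w. ((\<lambda>t. gchart g (\<gamma> t)) has_vector_derivative w) (at t within {0..1}) \<and>
         (a has_vector_derivative - (connection_form g (gchart g (\<gamma> t)) w *v a t)) (at t within {0..1})"
    using assms unfolding parallel_along_def by blast
  then show ?thesis unfolding Let_def using that by blast
qed

text \<open>
  Compatibility of the connection with the metric. In a gauge the pairing is
  \<open>\<Sum> a\<^sub>j (cnj b\<^sub>k) H\<^sub>j\<^sub>k\<close>. By the product rule its derivative consists of the
  terms of \<open>H'\<close>, which contain the connection form \<open>A\<close>, and those of \<open>a' = - A a\<close> and \<open>b' = - A b\<close>, and
  they cancel. Parallel transport is therefore isometric, and transport along the reversed path is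
  the adjoint.
\<close>

lemma parallel_pairing_constant:
  fixes h :: "'a::metric_space \<Rightarrow> complex ^ 'r::finite \<Rightarrow> complex ^ 'r \<Rightarrow> complex"
  assumes flat_bundle: "flat_unitary_bundle X h \<G>"
    and s: "parallel_along X \<G> \<gamma> s" and s': "parallel_along X \<G> \<gamma> s'"
  shows "h (\<gamma> 0) (s 0) (s' 0) = h (\<gamma> 1) (s 1) (s' 1)"
proof -
  define F where "F t = h (\<gamma> t) (s t) (s' t)" for t
  have path: "continuous_on {0..1} \<gamma>" and im: "\<gamma> ` {0..1} \<subseteq> X - singular_points X"
    using s unfolding parallel_along_def path_def path_image_def by auto
  have "(F has_vector_derivative 0) (at t within {0..1})" if t: "t \<in> {0..1}" for t
  proof -
    have "\<gamma> t \<in> X - singular_points X" using imageI[OF t, of \<gamma>] im by blast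
    then obtain g where g: "g \<in> \<G>" "\<gamma> t \<in> gdom g"
      using flat_bundle unfolding flat_unitary_bundle_def by blast
    have gauge: "gauge_on X g" and metric: "preserves_metric h g"
      using flat_bundle g(1) unfolding flat_unitary_bundle_def by blast+
    define S where "S = gchart g ` gdom g"
    define M where "M t = gframe g (\<gamma> t)" for t
    define z where "z t = gchart g (\<gamma> t)" for t
    define a b where "a t = matrix_inv (M t) *v s t" and "b t = matrix_inv (M t) *v s' t" for t
    obtain w where w: "(z has_vector_derivative w) (at t within {0..1})"
      and a: "(a has_vector_derivative - (connection_form g (z t) w *v a t)) (at t within {0..1})"
      using parallel_alongE[OF s g t] unfolding z_def a_def M_def by blast
    obtain w' where w': "(z has_vector_derivative w') (at t within {0..1})"
      and b': "(b has_vector_derivative - (connection_form g (z t) w' *v b t)) (at t within {0..1})"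
      using parallel_alongE[OF s' g t] unfolding z_def b_def M_def by blast
    have "w = w'"
      using w w' t vector_derivative_unique_within_closed_interval[of 0 1 t z w w'] by simp
    define A where "A = connection_form g (z t) w"
    have a: "(a has_vector_derivative - (A *v a t)) (at t within {0..1})"
      and b: "(b has_vector_derivative - (A *v b t)) (at t within {0..1})"
      using a b' \<open>w = w'\<close> by (simp_all add: A_def)
    obtain \<epsilon> where \<epsilon>: "\<epsilon> > 0" "\<And>u. u \<in> {0..1} \<Longrightarrow> dist u t < \<epsilon> \<Longrightarrow> \<gamma> u \<in> gdom g"
    proof -
      have "openin (top_of_set X) (gdom g)" using gauge by (simp add: gauge_on_def)
      then obtain U where U: "open U" "gdom g = X \<inter> U" by (auto simp: openin_open)
      then obtain e where e: "e > 0" "ball (\<gamma> t) e \<subseteq> U" using g(2) open_contains_ball by blast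
      obtain d where "d > 0" "\<And>u. u \<in> {0..1} \<Longrightarrow> dist u t < d \<Longrightarrow> dist (\<gamma> u) (\<gamma> t) < e"
        using path t e(1) unfolding continuous_on_iff by blast
      then show ?thesis using that[of d] e(2) U(2) im by (force simp: dist_commute)
    qed
    \<comment> \<open>A relative neighbourhood of \<open>t\<close> which the path maps into the gauge.\<close>
    define T where "T = {0..1} \<inter> ball t \<epsilon>"
    have at_T: "at t within T = at t within {0..1}"
      unfolding T_def using \<epsilon>(1) by (intro at_within_nhd[of t "ball t \<epsilon>"]) auto
    have tT: "t \<in> T" using t \<epsilon>(1) by (simp add: T_def)
    have dom: "\<gamma> u \<in> gdom g" if "u \<in> T" for u
      using that \<epsilon>(2) by (auto simp: T_def dist_commute)
    have zT: "z ` T \<subseteq> S" using dom by (auto simp: z_def S_def)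
    have inj: "inj_on (gchart g) (gdom g)"
    proof (rule inj_onI)
      fix x y assume "x \<in> gdom g" "y \<in> gdom g" "gchart g x = gchart g y"
      moreover from this have "dist (gchart g x) (gchart g y) = dist x y"
        using gauge unfolding gauge_on_def by blast
      ultimately show "x = y" by simp
    qed
    have inv: "M u *v (matrix_inv (M u) *v v) = v" if "u \<in> T" for u v
    proof -
      have "invertible (M u)" using gauge dom[OF that] by (simp add: gauge_on_def M_def)
      then have "M u ** matrix_inv (M u) = mat 1"
        unfolding invertible_def matrix_inv_def by (rule someI2_ex) blast
      then show ?thesis by (simp add: matrix_vector_mul_assoc)
    qed
    have herm: "hermitian_product (h (\<gamma> u))" if "u \<in> {0..1}" for u
      using flat_bundle im that unfolding flat_unitary_bundle_def by blast
    define H where "H j k u = h (\<gamma> u) (M u *v axis j 1) (M u *v axis k 1)" for j k u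
    define H' where "H' j k = h (\<gamma> t) (M t *v (A *v axis j 1)) (M t *v axis k 1)
      + h (\<gamma> t) (M t *v axis j 1) (M t *v (A *v axis k 1))" for j k
    have H: "(H j k has_vector_derivative H' j k) (at t within T)" for j k
    proof -
      define G where "G = in_chart g (\<lambda>x. h x (gframe g x *v axis j 1) (gframe g x *v axis k 1))"
      define G' where "G' v = h (\<gamma> t) (M t *v (connection_form g (z t) v *v axis j 1)) (M t *v axis k 1)
        + h (\<gamma> t) (M t *v axis j 1) (M t *v (connection_form g (z t) v *v axis k 1))" for v
      have "(G has_derivative G') (at (z t) within S)"
        using metric g(2) unfolding preserves_metric_def Let_def G_def G'_def[abs_def] S_def z_def M_def
        by blast
      then have G: "(G has_derivative G') (at (z t) within z ` T)"
        using zT by (rule has_derivative_subset)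
      have "(z has_vector_derivative w) (at t within T)" using w at_T by simp
      then have "(z has_derivative (\<lambda>x. x *\<^sub>R w)) (at t within T)"
        by (simp add: has_vector_derivative_def)
      from diff_chain_within[OF this G]
      have "(G \<circ> z has_derivative G' \<circ> (\<lambda>x. x *\<^sub>R w)) (at t within T)" .
      moreover have "(G' \<circ> (\<lambda>x. x *\<^sub>R w)) = (\<lambda>x. x *\<^sub>R G' w)"
        using linear_simps(5)[OF has_derivative_bounded_linear[OF G]] by (auto simp: o_def)
      ultimately have "(G \<circ> z has_vector_derivative G' w) (at t within T)"
        by (simp add: has_vector_derivative_def)
      moreover have "(G \<circ> z) u = H j k u" if "u \<in> T" for u
        using inv_into_f_f[OF inj dom[OF that]]
        by (simp add: G_def in_chart_def z_def H_def M_def)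
      moreover have "G' w = H' j k" by (simp add: G'_def H'_def A_def)
      ultimately show ?thesis
        using has_vector_derivative_transform[OF tT, of "H j k" "G \<circ> z"] by simp
    qed
    define F' where "F' = (\<Sum>j\<in>UNIV. \<Sum>k\<in>UNIV. a t $ j * cnj (b t $ k) * H' j k
        + (a t $ j * cnj ((- (A *v b t)) $ k) + (- (A *v a t)) $ j * cnj (b t $ k)) * H j k t)"
    have "((\<lambda>u. \<Sum>j\<in>UNIV. \<Sum>k\<in>UNIV. a u $ j * cnj (b u $ k) * H j k u) has_vector_derivative F')
        (at t within T)"
      unfolding F'_def
    proof (intro has_vector_derivative_sum has_vector_derivative_mult H)
      fix j k
      show "((\<lambda>u. a u $ j) has_vector_derivative (- (A *v a t)) $ j) (at t within T)"
        using bounded_linear.has_vector_derivative[OF bounded_linear_vec_nth a] at_T by simp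
      have "((\<lambda>u. b u $ k) has_vector_derivative (- (A *v b t)) $ k) (at t within T)"
        using bounded_linear.has_vector_derivative[OF bounded_linear_vec_nth b] at_T by simp
      then show "((\<lambda>u. cnj (b u $ k)) has_vector_derivative cnj ((- (A *v b t)) $ k)) (at t within T)"
        by (rule bounded_linear.has_vector_derivative[OF bounded_linear_cnj])
    qed
    moreover have "F u = (\<Sum>j\<in>UNIV. \<Sum>k\<in>UNIV. a u $ j * cnj (b u $ k) * H j k u)" if "u \<in> T" for u
    proof -
      have "F u = h (\<gamma> u) (M u *v a u) (M u *v b u)"
        by (simp add: F_def a_def b_def inv[OF that])
      then show ?thesis
        using hermitian_product_matrix_expansion[OF herm, of u "M u" "a u" "M u" "b u"] that
        by (simp add: H_def T_def)
    qed
    ultimately have F: "(F has_vector_derivative F') (at t within T)"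
      by (intro has_vector_derivative_transform[OF tT, of F])
    note exp = hermitian_product_matrix_expansion[OF herm[OF t]]
    have "F' = h (\<gamma> t) ((M t ** A) *v a t) (M t *v b t) + h (\<gamma> t) (M t *v a t) ((M t ** A) *v b t)
        + h (\<gamma> t) (M t *v a t) (M t *v (- (A *v b t))) + h (\<gamma> t) (M t *v (- (A *v a t))) (M t *v b t)"
      unfolding exp[of "M t ** A" "a t" "M t" "b t"] exp[of "M t" "a t" "M t ** A" "b t"]
        exp[of "M t" "a t" "M t" "- (A *v b t)"] exp[of "M t" "- (A *v a t)" "M t" "b t"]
        F'_def H'_def H_def
      unfolding sum.distrib[symmetric]
      by (intro sum.cong refl) (simp add: algebra_simps matrix_vector_mul_assoc)
    also have "\<dots> = 0"
    proof -
      have neg: "M t *v (- v) = - (M t *v v)" for v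
        using matrix_vector_mult_diff_distrib[of "M t" 0 v] by simp
      show ?thesis
        unfolding neg hermitian_product_rules(6,10)[OF herm[OF t]] matrix_vector_mul_assoc[symmetric]
        by simp
    qed
    finally show ?thesis using F at_T by simp
  qed
  then obtain c where "\<And>t. t \<in> {0..1} \<Longrightarrow> F t = c"
    using has_vector_derivative_zero_constant[of "{0..1::real}" F] by (metis convex_real_interval(5))
  then have "F 0 = F 1" by simp
  then show ?thesis by (simp add: F_def)
qed

lemma parallel_along_reversepath:
  assumes "parallel_along X \<G> \<gamma> s"
  shows "parallel_along X \<G> (reversepath \<gamma>) (\<lambda>t. s (1 - t))"
  unfolding parallel_along_def
proof (intro conjI ballI impI)
  show "path (reversepath \<gamma>)" "path_image (reversepath \<gamma>) \<subseteq> X - singular_points X"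
    using assms by (simp_all add: parallel_along_def)
  fix g t assume g: "g \<in> \<G>" and t: "t \<in> {0..1::real}" and dom: "reversepath \<gamma> t \<in> gdom g"
  define z where "z u = gchart g (\<gamma> u)" for u
  define a where "a u = matrix_inv (gframe g (\<gamma> u)) *v s u" for u
  have t': "1 - t \<in> {0..1}" using t by auto
  have dom': "\<gamma> (1 - t) \<in> gdom g" using dom by (simp add: reversepath_def)
  obtain w where w: "(z has_vector_derivative w) (at (1 - t) within {0..1})"
    "(a has_vector_derivative - (connection_form g (z (1 - t)) w *v a (1 - t))) (at (1 - t) within {0..1})"
    using parallel_alongE[OF assms g dom' t'] unfolding z_def a_def by blast
  have flip: "((\<lambda>u. 1 - u) has_vector_derivative -1) (at t within {0..1::real})"
    by (auto intro!: derivative_eq_intros)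
  have im: "(\<lambda>u. 1 - u) ` {0..1} = {0..1::real}"
    using image_diff_atLeastAtMost[of 1 0 "1::real"] by simp
  have 1: "((\<lambda>u. z (1 - u)) has_vector_derivative - w) (at t within {0..1})"
    using vector_diff_chain_within[OF flip, of z w] w(1) im by (simp add: o_def)
  have "((\<lambda>u. a (1 - u)) has_vector_derivative connection_form g (z (1 - t)) w *v a (1 - t)) (at t within {0..1})"
    using vector_diff_chain_within[OF flip, of a] w(2) im by (fastforce simp: o_def)
  moreover have "connection_form g (z (1 - t)) w *v a (1 - t)
      = - (connection_form g (z (1 - t)) (- w) *v a (1 - t))"
  proof -
    have "connection_form g (z (1 - t)) (- w) = - connection_form g (z (1 - t)) w"
      by (simp add: connection_form_def)
    moreover have "(- B) *v v = - (B *v v)" for B :: "complex ^ 'b ^ 'b" and v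
      using matrix_vector_mult_diff_rdistrib[of 0 B v] by simp
    ultimately show ?thesis by simp
  qed
  ultimately have 2: "((\<lambda>u. a (1 - u)) has_vector_derivative
      - (connection_form g (z (1 - t)) (- w) *v a (1 - t))) (at t within {0..1})" by simp
  show "let a = \<lambda>t. matrix_inv (gframe g (reversepath \<gamma> t)) *v s (1 - t)
     in \<exists>w. ((\<lambda>t. gchart g (reversepath \<gamma> t)) has_vector_derivative w) (at t within {0..1}) \<and>
        (a has_vector_derivative - (connection_form g (gchart g (reversepath \<gamma> t)) w *v a t)) (at t within {0..1})"
    using 1 2 unfolding Let_def reversepath_def z_def a_def by (intro exI[of _ "- w"] conjI)
qed

section \<open>Sections over the discretized surface\<close>

lemma center_in_surface:
  assumes "square_tiling X I \<tau>" "x \<in> darts I n" "n \<ge> 1"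
  shows "center \<tau> n x \<in> X"
proof -
  have "dart_tile x \<in> I" using assms(2) by (auto simp: darts_def)
  moreover have "(\<Union>i\<in>I. \<tau> i ` unit_square) = X" using assms(1) by (simp add: square_tiling_def)
  ultimately show ?thesis
    using local_center_in_unit_square(2)[OF assms(2,3)] unfolding center_def by blast
qed

text \<open>
  At the midpoint, either orientation of the segment takes its value from the tile of its first dart.
  The sides agree as sets, which alone does not identify their midpoints; the continuity of the
  segment does.
\<close>

lemma edge_segment_swap:
  fixes \<tau> :: "'i \<Rightarrow> real \<times> real \<Rightarrow> 'a::metric_space"
  assumes path: "path (edge_segment \<tau> n (x, y))" and n: "n \<ge> 1" and y: "y \<in> darts I n"
    and cont: "continuous_on unit_square (\<tau> (dart_tile y))"
  shows "edge_segment \<tau> n (y, x) = reversepath (edge_segment \<tau> n (x, y))"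
proof -
  define \<gamma> where "\<gamma> = edge_segment \<tau> n (x, y)"
  define d where "d = dart_direction y"
  define g where "g t = \<tau> (dart_tile y) (local_center n y + ((1 - t) / n) *\<^sub>R d)" for t
  have in_tile: "local_center n y + ((1 - t) / n) *\<^sub>R d \<in> unit_square" if "t \<in> {1/2..1}" for t
  proof -
    have "d \<in> directions" using y by (auto simp: d_def darts_def)
    moreover define r where "r = (1 - t) / n"
    have "0 \<le> r" "r \<le> 1 / (2 * real n)"
      using that n by (auto simp: r_def field_simps)
    ultimately show ?thesis
      using local_center_bounds[OF y n] unfolding r_def[symmetric]
      unfolding directions_def unit_square_def mem_Times_iff atLeastAtMost_iff by auto
  qed
  have "continuous_on {1/2..1} (\<lambda>t. local_center n y + ((1 - t) / n) *\<^sub>R d)"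
    using n by (intro continuous_intros) auto
  then have "continuous_on {1/2..1} g"
    unfolding g_def by (rule continuous_on_compose2[OF cont]) (use in_tile in blast)
  then have g: "(g \<longlongrightarrow> g (1/2)) (at (1/2) within {1/2..1})"
    unfolding continuous_on_def by simp
  have "continuous_on {0..1} \<gamma>" using path unfolding \<gamma>_def path_def .
  then have "(\<gamma> \<longlongrightarrow> \<gamma> (1/2)) (at (1/2) within {0..1})"
    unfolding continuous_on_def by simp
  then have "(\<gamma> \<longlongrightarrow> \<gamma> (1/2)) (at (1/2) within {1/2..1})"
    by (rule tendsto_within_subset) auto
  moreover have "\<forall>\<^sub>F t in at (1/2) within {1/2..1}. \<gamma> t = g t"
    unfolding eventually_at_filter by (rule always_eventually) (simp add: \<gamma>_def g_def d_def)
  ultimately have "(g \<longlongrightarrow> \<gamma> (1/2)) (at (1/2) within {1/2..1})"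
    by (rule Lim_transform_eventually)
  then have mid: "\<gamma> (1/2) = g (1/2)"
    using g by (intro tendsto_unique) (auto simp: at_within_Icc_at_right)
  show ?thesis
  proof
    fix t :: real
    consider "t < 1/2" | "t = 1/2" | "t > 1/2" by linarith
    then show "edge_segment \<tau> n (y, x) t = reversepath (edge_segment \<tau> n (x, y)) t"
    proof cases
      case 2
      have "edge_segment \<tau> n (y, x) (1/2) = g (1/2)" by (simp add: g_def d_def)
      also have "\<dots> = \<gamma> (1/2)" using mid by simp
      finally have "edge_segment \<tau> n (y, x) (1/2) = edge_segment \<tau> n (x, y) (1/2)"
        unfolding \<gamma>_def .
      moreover have "1 - t = 1/2" using 2 by simp
      ultimately show ?thesis unfolding reversepath_def by (simp only: 2)
    qed (simp_all add: reversepath_def)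
  qed
qed

lemma oriented_edges_sym: "(x, y) \<in> oriented_edges I \<tau> n \<Longrightarrow> (y, x) \<in> oriented_edges I \<tau> n"
  by (auto simp: oriented_edges_def)

lemma tile_continuous:
  assumes "locally_isometric_on S \<tau>"
  shows "continuous_on S \<tau>"
  unfolding continuous_on_iff
proof (intro ballI allI impI)
  fix z and e :: real assume z: "z \<in> S" and "e > 0"
  obtain \<epsilon> where \<epsilon>: "\<epsilon> > 0" "\<And>x y. x \<in> S \<inter> ball z \<epsilon> \<Longrightarrow> y \<in> S \<inter> ball z \<epsilon> \<Longrightarrow> dist (\<tau> x) (\<tau> y) = dist x y"
    using assms z unfolding locally_isometric_on_def by blast
  show "\<exists>d>0. \<forall>x'\<in>S. dist x' z < d \<longrightarrow> dist (\<tau> x') (\<tau> z) < e"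
  proof (intro exI[of _ "min e \<epsilon>"] conjI ballI impI)
    fix x' assume x': "x' \<in> S" "dist x' z < min e \<epsilon>"
    then have "dist (\<tau> x') (\<tau> z) = dist x' z"
      using \<epsilon>(1) z by (intro \<epsilon>(2)) (auto simp: dist_commute)
    then show "dist (\<tau> x') (\<tau> z) < e" using x' by simp
  qed (use \<open>e > 0\<close> \<epsilon>(1) in auto)
qed

text \<open>
  The transport along the reversed edge is inverse to the transport along the edge, hence its
  adjoint, because both are unitary. In terms of parallel sections this is the constancy of one
  pairing.
\<close>

lemma transport_adjoint:
  fixes h :: "'a::metric_space \<Rightarrow> complex ^ 'r::finite \<Rightarrow> complex ^ 'r \<Rightarrow> complex"
  assumes tiling: "square_tiling X I \<tau>" and flat: "flat_unitary_bundle X h \<G>"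
    and transport: "\<And>e. e \<in> oriented_edges I \<tau> n \<Longrightarrow>
          is_parallel_transport X \<G> (edge_segment \<tau> n e) (\<phi> e)"
    and n: "n \<ge> 1" and e: "(x, y) \<in> oriented_edges I \<tau> n"
  shows "h (center \<tau> n x) u (\<phi> (y, x) v) = h (center \<tau> n y) (\<phi> (x, y) u) v"
    and "h (center \<tau> n x) (\<phi> (y, x) v) (\<phi> (y, x) v) = h (center \<tau> n y) v v"
proof -
  obtain s where s: "parallel_along X \<G> (edge_segment \<tau> n (x, y)) s" "s 0 = u" "s 1 = \<phi> (x, y) u"
    using transport[OF e] unfolding is_parallel_transport_def by blast
  obtain s' where s': "parallel_along X \<G> (edge_segment \<tau> n (y, x)) s'" "s' 0 = v" "s' 1 = \<phi> (y, x) v"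
    using transport[OF oriented_edges_sym[OF e]] unfolding is_parallel_transport_def by blast
  have y: "y \<in> darts I n" and x: "x \<in> darts I n" using e by (auto simp: oriented_edges_def)
  then have "dart_tile x \<in> I" by (auto simp: darts_def)
  then have "continuous_on unit_square (\<tau> (dart_tile x))"
    using tiling by (intro tile_continuous) (auto simp: square_tiling_def)
  then have "edge_segment \<tau> n (x, y) = reversepath (edge_segment \<tau> n (y, x))"
    using edge_segment_swap[OF _ n x] s'(1) unfolding parallel_along_def by blast
  then have "parallel_along X \<G> (edge_segment \<tau> n (x, y)) (\<lambda>t. s' (1 - t))"
    using parallel_along_reversepath[OF s'(1)] by simp
  from parallel_pairing_constant[OF flat s(1) this]
  show "h (center \<tau> n x) u (\<phi> (y, x) v) = h (center \<tau> n y) (\<phi> (x, y) u) v"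
    using s s' by (simp add: center_def)
  from parallel_pairing_constant[OF flat s'(1) s'(1)]
  show "h (center \<tau> n x) (\<phi> (y, x) v) (\<phi> (y, x) v) = h (center \<tau> n y) v v"
    using s' by (simp add: center_def)
qed

text \<open>
  The passage from sections to scalars. The inequality at a vertex is the real part of the scalar
  product of the Laplacian with the section, estimated by Cauchy-Schwarz. The absolute value makes
  \<open>w\<close> nonnegative also off the surface, where \<open>h\<close> is arbitrary.
\<close>

lemma section_subsolution_graph:
  fixes h :: "'a::metric_space \<Rightarrow> complex ^ 'r::finite \<Rightarrow> complex ^ 'r \<Rightarrow> complex"
  assumes tiling: "square_tiling X I \<tau>" and flat: "flat_unitary_bundle X h \<G>"
    and transport: "\<And>e. e \<in> oriented_edges I \<tau> n \<Longrightarrow>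
          is_parallel_transport X \<G> (edge_segment \<tau> n e) (\<phi> e)"
    and n: "n \<ge> 1" and \<mu>: "\<mu> \<ge> 0"
    and laplace: "\<And>P. P \<in> vertices I \<tau> n \<Longrightarrow>
          fibre_norm h P (laplacian I \<tau> n \<phi> f P) \<le> \<mu> * fibre_norm h P (f P)"
  defines "w \<equiv> \<lambda>v. \<bar>fibre_norm h v (f v)\<bar>"
    and "c \<equiv> \<lambda>x y. Re (h (center \<tau> n x) (f (center \<tau> n x)) (\<phi> (y, x) (f (center \<tau> n y))))"
  shows "subsolution_graph (vertices I \<tau> n) (oriented_edges I \<tau> n) (center \<tau> n) w c \<mu>" (is ?graph)
    and "(x, y) \<in> oriented_edges I \<tau> n \<Longrightarrow> subsolution_graph.jump (center \<tau> n) w c x y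
      = fibre_norm h (center \<tau> n x) (f (center \<tau> n x) - \<phi> (y, x) (f (center \<tau> n y)))"
proof -
  have fin: "finite I" using tiling by (simp add: square_tiling_def)
  have herm: "hermitian_product (h v)" if "v \<in> vertices I \<tau> n" for v
    using that flat center_in_surface[OF tiling _ n] unfolding vertices_def flat_unitary_bundle_def by blast
  have w: "w v = fibre_norm h v (f v)" "(w v)\<^sup>2 = Re (h v (f v) (f v))" if "v \<in> vertices I \<tau> n" for v
    using fibre_norm_nonneg[of h v, OF herm[OF that]] fibre_norm_squared[of h v, OF herm[OF that]]
    by (simp_all add: w_def)
  have vert: "center \<tau> n x \<in> vertices I \<tau> n" "center \<tau> n y \<in> vertices I \<tau> n"
    if "(x, y) \<in> oriented_edges I \<tau> n" for x y
    using that by (auto simp: vertices_def oriented_edges_def)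
  have \<phi>_norm: "fibre_norm h (center \<tau> n x) (\<phi> (y, x) (f (center \<tau> n y))) = w (center \<tau> n y)"
    if "(x, y) \<in> oriented_edges I \<tau> n" for x y
    using transport_adjoint(2)[OF tiling flat transport n that] w(1)[OF vert(2)[OF that]]
    by (simp add: fibre_norm_def)
  show graph: ?graph
  proof
    show "finite (vertices I \<tau> n)" unfolding vertices_def using finite_darts[OF fin] by simp
    show "finite (oriented_edges I \<tau> n)" using finite_oriented_edges[OF fin] .
    show "w v \<ge> 0" for v by (simp add: w_def)
    fix x y assume e: "(x, y) \<in> oriented_edges I \<tau> n"
    show "(y, x) \<in> oriented_edges I \<tau> n" "center \<tau> n x \<in> vertices I \<tau> n"
      using e oriented_edges_sym vert by blast+
    show "c y x = c x y"
      using transport_adjoint(1)[OF tiling flat transport n e]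
        hermitian_product_rules(3)[OF herm[OF vert(2)[OF e]],
          of "f (center \<tau> n y)" "\<phi> (x, y) (f (center \<tau> n x))"]
      unfolding c_def by simp
    show "\<bar>c x y\<bar> \<le> w (center \<tau> n x) * w (center \<tau> n y)"
      using fibre_Cauchy_Schwarz[of h "center \<tau> n x", OF herm[OF vert(1)[OF e]]] \<phi>_norm[OF e] w(1)[OF vert(1)[OF e]]
      unfolding c_def by metis
  next
    fix v assume v: "v \<in> vertices I \<tau> n"
    note rules = hermitian_product_rules[OF herm[OF v]]
    have "(\<Sum>(x, y) | (x, y) \<in> oriented_edges I \<tau> n \<and> center \<tau> n x = v. (w v)\<^sup>2 - c x y)
        = (\<Sum>e | e \<in> oriented_edges I \<tau> n \<and> center \<tau> n (fst e) = v.
            Re (h v (f v - \<phi> (snd e, fst e) (f (center \<tau> n (snd e)))) (f v)))"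
    proof (intro sum.cong)
      fix e assume "e \<in> {e. e \<in> oriented_edges I \<tau> n \<and> center \<tau> n (fst e) = v}"
      then show "(case e of (x, y) \<Rightarrow> (w v)\<^sup>2 - c x y)
          = Re (h v (f v - \<phi> (snd e, fst e) (f (center \<tau> n (snd e)))) (f v))"
        using rules(3)[of "\<phi> (snd e, fst e) (f (center \<tau> n (snd e)))" "f v"]
        by (auto simp: w(2)[OF v] c_def rules(4) case_prod_unfold)
    qed auto
    also have "\<dots> = Re (h v (laplacian I \<tau> n \<phi> f v) (f v))"
      unfolding laplacian_def hermitian_product_sum_left[OF herm[OF v]]
      by (simp add: case_prod_unfold)
    also have "\<dots> \<le> fibre_norm h v (laplacian I \<tau> n \<phi> f v) * fibre_norm h v (f v)"
      using fibre_Cauchy_Schwarz[of h v, OF herm[OF v]] by (metis abs_le_D1)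
    also have "\<dots> \<le> \<mu> * fibre_norm h v (f v) * fibre_norm h v (f v)"
      using laplace[OF v] fibre_norm_nonneg[of h v, OF herm[OF v]] by (rule mult_right_mono)
    finally show "(\<Sum>(x, y) | (x, y) \<in> oriented_edges I \<tau> n \<and> center \<tau> n x = v. (w v)\<^sup>2 - c x y)
        \<le> \<mu> * (w v)\<^sup>2"
      using w(1)[OF v] by (simp add: power2_eq_square mult.assoc)
  qed (rule \<mu>)
  assume e: "(x, y) \<in> oriented_edges I \<tau> n"
  let ?v = "center \<tau> n x" and ?b = "\<phi> (y, x) (f (center \<tau> n y))"
  note rules = hermitian_product_rules[OF herm[OF vert(1)[OF e]]]
  have "Re (h ?v ?b ?b) = (w (center \<tau> n y))\<^sup>2"
    using fibre_norm_squared[of h ?v, OF herm[OF vert(1)[OF e]]] \<phi>_norm[OF e] by metis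
  then have "Re (h ?v (f ?v - ?b) (f ?v - ?b)) = (w ?v)\<^sup>2 + (w (center \<tau> n y))\<^sup>2 - 2 * c x y"
    using rules(3)[of ?b "f ?v"] by (simp add: rules(4,9) w(2)[OF vert(1)[OF e]] c_def)
  then show "subsolution_graph.jump (center \<tau> n) w c x y = fibre_norm h ?v (f ?v - ?b)"
    unfolding subsolution_graph.jump_def[OF graph] fibre_norm_def by simp
qed

text \<open>
  The interiors of the tiles are embedded disjointly, so a vertex determines its tile and its
  position there. The direction \<open>(1, 0)\<close> is arbitrary: the centre does not depend on it.
\<close>

lemma sum_over_vertices:
  assumes tiling: "square_tiling X I \<tau>" and n: "n \<ge> 1"
  shows "(\<Sum>v\<in>vertices I \<tau> n. g v)
    = (\<Sum>i\<in>I. \<Sum>a<n. \<Sum>b<n. g (center \<tau> n (i, a, b, 1, 0)))"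
proof -
  let ?c = "\<lambda>(i, a, b). center \<tau> n (i, a, b, 1, 0)"
  have "inj_on ?c (I \<times> {..<n} \<times> {..<n})"
  proof (rule inj_onI)
    fix s t assume s: "s \<in> I \<times> {..<n} \<times> {..<n}" and t: "t \<in> I \<times> {..<n} \<times> {..<n}"
      and eq: "?c s = ?c t"
    obtain i a b j k l where st: "s = (i, a, b)" "t = (j, k, l)" by (cases s, cases t)
    have "(i, a, b, 1, 0) \<in> darts I n" "(j, k, l, 1, 0) \<in> darts I n"
      using s t st by (auto simp: darts_def directions_def)
    then have "(i, local_center n (i, a, b, 1, 0)) \<in> I \<times> open_square"
      "(j, local_center n (j, k, l, 1, 0)) \<in> I \<times> open_square"
      using s t st local_center_in_unit_square(1)[OF _ n] by blast+
    moreover have "inj_on (\<lambda>(i, z). \<tau> i z) (I \<times> open_square)"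
      using tiling by (simp add: square_tiling_def)
    ultimately have "(i, local_center n (i, a, b, 1, 0)) = (j, local_center n (j, k, l, 1, 0))"
      using eq unfolding st center_def inj_on_def by fastforce
    then show "s = t" using n by (simp add: st)
  qed
  moreover have "vertices I \<tau> n = ?c ` (I \<times> {..<n} \<times> {..<n})"
  proof -
    have "center \<tau> n (i, a, b, d) = center \<tau> n (i, a, b, 1, 0)" for i a b d
      by (simp add: center_def)
    then show ?thesis
      unfolding vertices_def darts_def directions_def by (force simp: image_iff)
  qed
  ultimately have "(\<Sum>v\<in>vertices I \<tau> n. g v)
      = (\<Sum>(i, a, b)\<in>I \<times> {..<n} \<times> {..<n}. g (center \<tau> n (i, a, b, 1, 0)))"
    by (simp add: sum.reindex case_prod_unfold)
  then show ?thesis by (simp add: sum.cartesian_product)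
qed

text \<open>
  Neighbouring small squares of one tile are joined by an edge: their common side is described from
  both of them, with opposite orientations.
\<close>

lemma grid_edges:
  assumes "i \<in> I" "n \<ge> 1"
  shows "Suc a < n \<Longrightarrow> b < n \<Longrightarrow> ((i, a, b, 1, 0), (i, Suc a, b, - 1, 0)) \<in> oriented_edges I \<tau> n"
    and "a < n \<Longrightarrow> Suc b < n \<Longrightarrow> ((i, a, b, 0, 1), (i, a, Suc b, 0, - 1)) \<in> oriented_edges I \<tau> n"
proof -
  have sym: "(\<lambda>s. - s) ` {- 1/2..1/2} = {- 1/2..1/2::real}" by simp
  have eq: "side (c + (1 / n) *\<^sub>R d) (1 / n) (- d) = side c (1 / n) d" for c d
  proof -
    have "side (c + (1 / n) *\<^sub>R d) (1 / n) (- d)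
        = (\<lambda>s. c + (1 / n / 2) *\<^sub>R d + (s * (1 / n)) *\<^sub>R quarter_turn d) ` (\<lambda>s. - s) ` {- 1/2..1/2}"
      unfolding side_def image_image
      by (intro image_cong) (auto simp: quarter_turn_def prod_eq_iff field_simps)
    then show ?thesis unfolding sym side_def .
  qed
  have step: "local_center n (i, Suc a, b, d) = local_center n (i, a, b, d') + (1 / n) *\<^sub>R (1, 0)"
    "local_center n (i, a, Suc b, d) = local_center n (i, a, b, d') + (1 / n) *\<^sub>R (0, 1)" for d d'
    using assms(2) by (auto simp: field_simps)
  show "((i, a, b, 1, 0), (i, Suc a, b, - 1, 0)) \<in> oriented_edges I \<tau> n" if "Suc a < n" "b < n"
    using that assms eq[of "local_center n (i, a, b, 1, 0)" "(1, 0)"]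
    by (simp add: oriented_edges_def dart_side_def darts_def directions_def step(1)[of "(- 1, 0)" "(1, 0)"]
        del: local_center.simps)
  show "((i, a, b, 0, 1), (i, a, Suc b, 0, - 1)) \<in> oriented_edges I \<tau> n" if "a < n" "Suc b < n"
    using that assms eq[of "local_center n (i, a, b, 0, 1)" "(0, 1)"]
    by (simp add: oriented_edges_def dart_side_def darts_def directions_def step(2)[of "(0, - 1)" "(0, 1)"]
        del: local_center.simps)
qed

text \<open>
  The sum of the inequalities for the tiles. The edges inside the tiles are distinct edges of the
  graph, and the edges across the sides of tiles contribute nonnegative terms to \<open>R\<close>.
\<close>

lemma surface_sobolev:
  fixes u :: "'a::metric_space \<Rightarrow> real"
  assumes tiling: "square_tiling X I \<tau>" and n: "n \<ge> 1"
  defines "S \<equiv> \<Sum>v\<in>vertices I \<tau> n. (u v)\<^sup>2"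
    and "R \<equiv> \<Sum>(x, y)\<in>oriented_edges I \<tau> n. (u (center \<tau> n x) - u (center \<tau> n y))\<^sup>2"
  shows "(\<Sum>v\<in>vertices I \<tau> n. (u v) ^ 4) \<le> 8 * S * (R + S / (real n)\<^sup>2)"
proof -
  have fin: "finite I" using tiling by (simp add: square_tiling_def)
  define U where "U i a b = u (center \<tau> n (i, a, b, 1, 0))" for i a b
  have U: "u (center \<tau> n (i, a, b, d)) = U i a b" for i a b d by (simp add: U_def center_def)
  define s where "s i = (\<Sum>a<n. \<Sum>b<n. (U i a b)\<^sup>2)" for i
  define rh where "rh i = (\<Sum>a<n - 1. \<Sum>b<n. (U i (Suc a) b - U i a b)\<^sup>2)" for i
  define rv where "rv i = (\<Sum>a<n. \<Sum>b<n - 1. (U i a (Suc b) - U i a b)\<^sup>2)" for i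
  have nn: "s i \<ge> 0" "rh i \<ge> 0" "rv i \<ge> 0" for i
    unfolding s_def rh_def rv_def by (auto intro!: sum_nonneg)
  have S: "S = (\<Sum>i\<in>I. s i)"
    unfolding S_def sum_over_vertices[OF tiling n] by (simp add: s_def U_def)
  have R: "(\<Sum>i\<in>I. rh i + rv i) \<le> R"
  proof -
    define eh where "eh = (\<lambda>(i::'b, a::nat, b::nat). ((i, a, b, 1::real, 0::real), (i, Suc a, b, - 1::real, 0::real)))"
    define ev where "ev = (\<lambda>(i::'b, a::nat, b::nat). ((i, a, b, 0::real, 1::real), (i, a, Suc b, 0::real, - 1::real)))"
    define J where "J e = (u (center \<tau> n (fst e)) - u (center \<tau> n (snd e)))\<^sup>2" for e
    let ?H = "I \<times> {..<n - 1} \<times> {..<n}" and ?V = "I \<times> {..<n} \<times> {..<n - 1}"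
    have inj: "inj_on eh ?H" "inj_on ev ?V" by (auto simp: inj_on_def eh_def ev_def)
    have "(\<Sum>i\<in>I. rh i) = sum J (eh ` ?H)"
      unfolding sum.reindex[OF inj(1)]
      by (simp add: rh_def sum.cartesian_product eh_def J_def U case_prod_unfold
          power2_commute)
    moreover have "(\<Sum>i\<in>I. rv i) = sum J (ev ` ?V)"
      unfolding sum.reindex[OF inj(2)]
      by (simp add: rv_def sum.cartesian_product ev_def J_def U case_prod_unfold
          power2_commute)
    moreover have "sum J (eh ` ?H) + sum J (ev ` ?V) = sum J (eh ` ?H \<union> ev ` ?V)"
      using fin by (intro sum.union_disjoint[symmetric]) (auto simp: eh_def ev_def)
    moreover have "\<dots> \<le> sum J (oriented_edges I \<tau> n)"
    proof (rule sum_mono2)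
      show "eh ` ?H \<union> ev ` ?V \<subseteq> oriented_edges I \<tau> n"
        using grid_edges[OF _ n] by (auto simp: eh_def ev_def less_diff_conv)
    qed (auto simp: J_def finite_oriented_edges[OF fin])
    moreover have "sum J (oriented_edges I \<tau> n) = R" by (simp add: J_def R_def case_prod_unfold)
    ultimately show ?thesis by (simp add: sum.distrib)
  qed
  have "(\<Sum>v\<in>vertices I \<tau> n. (u v) ^ 4) = (\<Sum>i\<in>I. \<Sum>a<n. \<Sum>b<n. (U i a b) ^ 4)"
    unfolding sum_over_vertices[OF tiling n] by (simp add: U_def)
  also have "\<dots> \<le> (\<Sum>i\<in>I. 8 * S * ((rh i + rv i) + s i / (real n)\<^sup>2))"
  proof (intro sum_mono)
    fix i assume "i \<in> I"
    then have "s i \<le> S" unfolding S using fin nn by (intro member_le_sum) auto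
    have "(\<Sum>a<n. \<Sum>b<n. (U i a b) ^ 4) \<le> 8 * s i * ((rh i + rv i) + s i / (real n)\<^sup>2)"
      unfolding s_def rh_def rv_def by (rule grid_sobolev[OF n])
    also have "\<dots> \<le> 8 * S * ((rh i + rv i) + s i / (real n)\<^sup>2)"
      using \<open>s i \<le> S\<close> nn by (intro mult_right_mono) auto
    finally show "(\<Sum>a<n. \<Sum>b<n. (U i a b) ^ 4) \<le> 8 * S * ((rh i + rv i) + s i / (real n)\<^sup>2)" .
  qed
  also have "\<dots> = 8 * S * ((\<Sum>i\<in>I. rh i + rv i) + S / (real n)\<^sup>2)"
    by (simp add: S sum_distrib_left[symmetric] sum.distrib sum_divide_distrib)
  also have "\<dots> \<le> 8 * S * (R + S / (real n)\<^sup>2)"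
    using R S nn by (intro mult_left_mono add_mono) (auto intro: sum_nonneg)
  finally show ?thesis .
qed

section \<open>Decay of the jumps\<close>

text \<open>
  The energy and mass constants of the graphs inserted into \<open>jump_estimate\<close>. For fixed \<open>K\<close> the first
  term tends to \<open>0\<close> as \<open>n\<close> grows, and the second is small for large \<open>K\<close>.
\<close>

lemma edge_jump_bound:
  fixes \<tau> :: "'i \<Rightarrow> real \<times> real \<Rightarrow> 'a::metric_space" and lam C \<delta> :: real
  assumes tiling: "square_tiling X I \<tau>"
    and iso: "\<And>i z z'. i \<in> I \<Longrightarrow> z \<in> unit_square \<Longrightarrow> z' \<in> unit_square \<Longrightarrow>
      dist z z' < \<delta> \<Longrightarrow> dist (\<tau> i z) (\<tau> i z') = dist z z'"
    and C: "\<And>p r. r \<ge> 1 \<Longrightarrow> card {x \<in> darts I n. n * dist (center \<tau> n x) p \<le> r} \<le> C * r\<^sup>2" "C > 0"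
    and n: "n \<ge> 1" "1 / n < \<delta>"
    and graph: "subsolution_graph (vertices I \<tau> n) (oriented_edges I \<tau> n) (center \<tau> n) w c (lam / (real n)\<^sup>2)"
    and mass: "(\<Sum>v\<in>vertices I \<tau> n. (w v)\<^sup>2) = (real n)\<^sup>2"
    and e0: "(x0, y0) \<in> oriented_edges I \<tau> n" and K: "K \<ge> 1"
  shows "(subsolution_graph.jump (center \<tau> n) w c x0 y0)\<^sup>2
    \<le> 64 * lam * (lam + 1) * C * (2 * 4 ^ K)\<^sup>2 / (real n)\<^sup>2
      + 8 * sqrt (32 * (lam + 1)) * sqrt (8 * C\<^sup>2 * lam / K)"
proof -
  let ?V = "vertices I \<tau> n" and ?E = "oriented_edges I \<tau> n" and ?q = "center \<tau> n"
  interpret subsolution_graph ?V ?E ?q w c "lam / (real n)\<^sup>2" by (rule graph)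
  have fin: "finite I" using tiling by (simp add: square_tiling_def)
  have N: "(real n)\<^sup>2 \<ge> 1" using n by simp
  have lam: "lam \<ge> 0" using mu_nonneg n by (simp add: zero_le_divide_iff)
  define D where "D v = n * dist v (?q x0)" for v
  have sup: "w v \<le> sqrt (32 * (lam + 1))" if "v \<in> ?V" for v
    using sup_bound[OF N mass refl surface_sobolev[OF tiling n(1)] that]
    by (rule real_le_rsqrt)
  have near: "n * dist (?q x) (?q y) \<le> 2" if "(x, y) \<in> ?E" for x y
  proof -
    have "n * dist (?q x) (?q y) \<le> n * (2 / n)"
      using adjacent_centers_near[OF iso n that] by (intro mult_left_mono) auto
    then show ?thesis using n by simp
  qed
  have lip: "\<bar>D (?q x) - D (?q y)\<bar> \<le> 2" if "(x, y) \<in> ?E" for x y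
  proof -
    have "\<bar>D (?q x) - D (?q y)\<bar> = n * \<bar>dist (?q x) (?q x0) - dist (?q y) (?q x0)\<bar>"
      by (simp add: D_def abs_mult flip: right_diff_distrib)
    also have "\<dots> \<le> n * dist (?q x) (?q y)"
      using abs_dist_diff_le[of "?q x" "?q x0" "?q y"]
      by (intro mult_left_mono) (auto simp: dist_commute)
    also have "\<dots> \<le> 2" by (rule near[OF that])
    finally show ?thesis .
  qed
  have vol: "card {v \<in> ?V. D v \<le> r} \<le> C * r\<^sup>2" if "r \<ge> 1" for r
  proof -
    have "{v \<in> ?V. D v \<le> r} = ?q ` {x \<in> darts I n. n * dist (?q x) (?q x0) \<le> r}"
      by (auto simp: vertices_def D_def)
    then have "card {v \<in> ?V. D v \<le> r} \<le> card {x \<in> darts I n. n * dist (?q x) (?q x0) \<le> r}"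
      using finite_darts[OF fin] by (simp add: card_image_le)
    then show ?thesis using C(1)[OF that, of "?q x0"] by linarith
  qed
  have edge_vol: "card {(x, y) \<in> ?E. D (?q x) \<le> r} \<le> (4 * C\<^sup>2) * r\<^sup>2" if "r \<ge> 1" for r
  proof -
    \<comment> \<open>An edge is a dart near \<open>x0\<close> with a neighbour, and by the ball bound of radius \<open>2\<close> it has at most
      \<open>4 C\<close> neighbours.\<close>
    let ?A = "{x \<in> darts I n. n * dist (?q x) (?q x0) \<le> r}"
    let ?B = "\<lambda>x. {y \<in> darts I n. n * dist (?q y) (?q x) \<le> 2}"
    have sub: "{(x, y) \<in> ?E. D (?q x) \<le> r} \<subseteq> Sigma ?A ?B"
    proof (rule subrelI)
      fix x y assume "(x, y) \<in> {(x, y) \<in> ?E. D (?q x) \<le> r}"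
      then have e: "(x, y) \<in> ?E" "D (?q x) \<le> r" by auto
      then show "(x, y) \<in> Sigma ?A ?B"
        using near[OF e(1)] by (simp add: oriented_edges_def D_def dist_commute)
    qed
    have finAB: "finite ?A" "finite (?B x)" for x using finite_darts[OF fin] by auto
    have "card {(x, y) \<in> ?E. D (?q x) \<le> r} \<le> card (Sigma ?A ?B)"
      using sub finAB by (intro card_mono) auto
    also have "real \<dots> = (\<Sum>x\<in>?A. real (card (?B x)))"
      using finAB by (subst card_SigmaI) auto
    also have "\<dots> \<le> (\<Sum>x\<in>?A. C * 2\<^sup>2)" by (intro sum_mono C(1)) auto
    also have "\<dots> = real (card ?A) * (4 * C)" by simp
    also have "\<dots> \<le> (C * r\<^sup>2) * (4 * C)"
      using C(1)[OF that, of "?q x0"] C(2) by (intro mult_right_mono) auto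
    finally show ?thesis by (simp add: power2_eq_square mult_ac)
  qed
  have "lam / (real n)\<^sup>2 * (\<Sum>v\<in>?V. (w v)\<^sup>2) \<le> lam" using n by (simp add: mass)
  from jump_estimate[OF this sup lip vol edge_vol e0 _ K]
  have "(jump x0 y0)\<^sup>2 \<le> 2 * (lam / (real n)\<^sup>2) * (sqrt (32 * (lam + 1)))\<^sup>2 * (C * (2 * 4 ^ K)\<^sup>2)
      + 8 * sqrt (32 * (lam + 1)) * sqrt (2 * (4 * C\<^sup>2) * lam / K)"
    by (simp add: D_def)
  also have "(sqrt (32 * (lam + 1)))\<^sup>2 = 32 * (lam + 1)" using lam by simp
  finally show ?thesis by (simp add: mult_ac)
qed

theorem theorem3p11:
  fixes X :: "'a::metric_space set"
    and I :: "'i set"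
    and \<tau> :: "'i \<Rightarrow> real \<times> real \<Rightarrow> 'a"
    and h :: "'a \<Rightarrow> complex ^ 'r::finite \<Rightarrow> complex ^ 'r \<Rightarrow> complex"
    and \<G> :: "('a, 'r) gauge set"
    and \<phi> :: "nat \<Rightarrow> 'i dart \<times> 'i dart \<Rightarrow> complex ^ 'r \<Rightarrow> complex ^ 'r"
    and f :: "nat \<Rightarrow> 'a \<Rightarrow> complex ^ 'r"
    and lam :: real
  assumes surface: "half_translation_surface X"
    and tiling: "square_tiling X I \<tau>"
    and flat_bundle: "flat_unitary_bundle X h \<G>"
    and transport: "\<And>n e. n \<ge> 1 \<Longrightarrow> e \<in> oriented_edges I \<tau> n \<Longrightarrow>
          is_parallel_transport X \<G> (edge_segment \<tau> n e) (\<phi> n e)"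
    and lam_pos: "lam > 0"
    and normalized: "\<And>n. n \<ge> 1 \<Longrightarrow>
          (\<Sum>v\<in>vertices I \<tau> n. (fibre_norm h v (f n v))\<^sup>2) = (real n)\<^sup>2"
    and almost_harmonic: "\<And>n P. n \<ge> 1 \<Longrightarrow> P \<in> vertices I \<tau> n \<Longrightarrow>
          fibre_norm h P (laplacian I \<tau> n (\<phi> n) (f n) P)
            \<le> lam / (real n)\<^sup>2 * fibre_norm h P (f n P)"
  shows "(\<lambda>n. Max ((\<lambda>(x, y). fibre_norm h (center \<tau> n x)
            (f n (center \<tau> n x) - \<phi> n (y, x) (f n (center \<tau> n y)))) ` oriented_edges I \<tau> n))
         \<longlonglongrightarrow> 0"
proof -
  have fin: "finite I" using tiling by (simp add: square_tiling_def)
  have "\<And>i. i \<in> I \<Longrightarrow> locally_isometric_on unit_square (\<tau> i)"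
    using tiling by (simp add: square_tiling_def)
  then obtain \<delta> where \<delta>: "\<delta> > 0" and iso: "\<And>i z z'. i \<in> I \<Longrightarrow> z \<in> unit_square \<Longrightarrow> z' \<in> unit_square \<Longrightarrow>
    dist z z' < \<delta> \<Longrightarrow> dist (\<tau> i z) (\<tau> i z') = dist z z'"
    using uniform_isometry_scale[OF fin] by metis
  obtain C :: real where C: "C > 0" "\<And>n p r. n \<ge> 1 \<Longrightarrow> r \<ge> 1 \<Longrightarrow>
    card {x \<in> darts I n. n * dist (center \<tau> n x) p \<le> r} \<le> C * r\<^sup>2"
    using darts_in_ball_bound[of I \<delta> \<tau>, OF fin \<delta> iso] by blast
  define J where "J n = (\<lambda>(x, y). fibre_norm h (center \<tau> n x)
      (f n (center \<tau> n x) - \<phi> n (y, x) (f n (center \<tau> n y))))" for n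
  define A where "A K = 64 * lam * (lam + 1) * C * (2 * 4 ^ K)\<^sup>2" for K :: nat
  define B where "B K = 8 * sqrt (32 * (lam + 1)) * sqrt (8 * C\<^sup>2 * lam / K)" for K :: nat
  have bound: "(J n e)\<^sup>2 \<le> A K / (real n)\<^sup>2 + B K" and nonneg: "J n e \<ge> 0"
    if e: "e \<in> oriented_edges I \<tau> n" and n: "n \<ge> 1" "1 / n < \<delta>" and K: "K \<ge> 1" for n e K
  proof -
    obtain x y where xy: "e = (x, y)" by (cases e)
    have mu: "lam / (real n)\<^sup>2 \<ge> 0" using lam_pos by simp
    define w where "w v = \<bar>fibre_norm h v (f n v)\<bar>" for v
    define c where "c x y = Re (h (center \<tau> n x) (f n (center \<tau> n x)) (\<phi> n (y, x) (f n (center \<tau> n y))))" for x y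
    have graph: "subsolution_graph (vertices I \<tau> n) (oriented_edges I \<tau> n) (center \<tau> n) w c (lam / (real n)\<^sup>2)"
      unfolding w_def c_def
      by (rule section_subsolution_graph(1)[OF tiling flat_bundle transport[OF n(1)] n(1) mu almost_harmonic[OF n(1)]])
    have J: "J n e = subsolution_graph.jump (center \<tau> n) w c x y"
      unfolding J_def xy prod.case w_def c_def
      by (rule section_subsolution_graph(2)[OF tiling flat_bundle transport[OF n(1)] n(1) mu almost_harmonic[OF n(1)],
            symmetric]) (use e xy in auto)
    have mass: "(\<Sum>v\<in>vertices I \<tau> n. (w v)\<^sup>2) = (real n)\<^sup>2"
      using normalized[OF n(1)] by (simp add: w_def)
    have exy: "(x, y) \<in> oriented_edges I \<tau> n" using e xy by simp
    show "J n e \<ge> 0" unfolding J by (rule subsolution_graph.jump_nonneg[OF graph exy])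
    show "(J n e)\<^sup>2 \<le> A K / (real n)\<^sup>2 + B K"
      unfolding J A_def B_def
      by (rule edge_jump_bound[OF tiling iso C(2) C(1) n graph mass exy K]) (use n in auto)
  qed
  have "\<forall>\<^sub>F n in sequentially. \<bar>Max (J n ` oriented_edges I \<tau> n)\<bar> < \<epsilon>" if \<epsilon>: "\<epsilon> > 0" for \<epsilon>
  proof -
    have "(\<lambda>K. 8 * sqrt (32 * (lam + 1)) * sqrt (8 * C\<^sup>2 * lam / real K)) \<longlonglongrightarrow> 8 * sqrt (32 * (lam + 1)) * sqrt 0"
      by (intro tendsto_mult tendsto_const tendsto_real_sqrt lim_const_over_n)
    then have "B \<longlonglongrightarrow> 0" by (simp add: B_def[abs_def])
    then have "\<forall>\<^sub>F K in sequentially. B K < \<epsilon>\<^sup>2 / 2"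
      using \<epsilon> by (intro order_tendstoD) auto
    then obtain K where K: "K \<ge> 1" "B K < \<epsilon>\<^sup>2 / 2"
      using eventually_happens[OF eventually_conj[OF _ eventually_ge_at_top[of 1]]] by force
    have "(\<lambda>n. A K / real n * (1 / real n)) \<longlonglongrightarrow> 0 * 0"
      by (intro tendsto_mult lim_const_over_n)
    then have "(\<lambda>n. A K / (real n)\<^sup>2) \<longlonglongrightarrow> 0" by (simp add: power2_eq_square)
    then have "\<forall>\<^sub>F n in sequentially. A K / (real n)\<^sup>2 < \<epsilon>\<^sup>2 / 2"
      using \<epsilon> by (intro order_tendstoD) auto
    moreover have "\<forall>\<^sub>F n in sequentially. 1 / real n < \<delta>"
      using \<delta> by (intro order_tendstoD[OF lim_const_over_n])
    ultimately show ?thesis using eventually_ge_at_top[of 2]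
    proof eventually_elim
      case (elim n)
      then have n: "n \<ge> 1" "1 / real n < \<delta>" by auto
      have "vertices I \<tau> n \<noteq> {}" using normalized[OF n(1)] n(1) by auto
      then obtain i where "i \<in> I" by (auto simp: vertices_def darts_def)
      then have "((i, 0, 0, 1, 0), (i, Suc 0, 0, - 1, 0)) \<in> oriented_edges I \<tau> n"
        using elim by (intro grid_edges(1)) auto
      then have ne: "J n ` oriented_edges I \<tau> n \<noteq> {}" by blast
      have finJ: "finite (J n ` oriented_edges I \<tau> n)" 
        by (rule finite_imageI[OF finite_oriented_edges[OF fin]])
      from Max_in[OF finJ ne] obtain e where e: "e \<in> oriented_edges I \<tau> n"
        "Max (J n ` oriented_edges I \<tau> n) = J n e" by auto
      have "(J n e)\<^sup>2 < \<epsilon>\<^sup>2" using bound[OF e(1) n K(1)] elim K(2) by linarith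
      then have "J n e < \<epsilon>" by (rule power2_less_imp_less) (use \<epsilon> in simp)
      then show ?case using nonneg[OF e(1) n K(1)] by (simp add: e(2))
    qed
  qed
  then have "(\<lambda>n. Max (J n ` oriented_edges I \<tau> n)) \<longlonglongrightarrow> 0"
    by (simp add: tendsto_iff dist_real_def)
  then show ?thesis by (simp add: J_def[abs_def])
qed

end
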